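(* For positive integers $m,\ell,n$ put $A:=\ell/m$ and $B:=n/m^2$, and let $d=d(A,B)$ be as defined in the context. Suppose $m$, $\ell$ and $n$ go to infinity so that $(A,B)$ remains in a compact subset $K$ of $\{(x,y)\in\mathbb{R}^2 : x\ge 2y>0\}$ and $$m^{-1}\,|n-\ell m/2|\to\infty.$$ Then $$N_{n+1}(\ell,m)-N_n(\ell,m)\sim\frac{d}{m}\,N_n(\ell,m).$$
   Context: $N_n(\ell,m)$ denotes the number of partitions $\lambda$ of $n$ with largest part at most $\ell$ and at most $m$ parts. The symbol $\sim$ means equality up to a factor $1+o(1)$. For $A>2B>0$, $(c,d)$ is the unique pair of positive real numbers satisfying $$A=\int_0^1\frac{1}{1-e^{-c-dt}}\,dt-1,\qquad B=\int_0^1\frac{t}{1-e^{-c-dt}}\,dt-\frac12.$$ In the case $A=2B$ one takes $d=0$ and $c=\log\frac{A+1}{A}$. *)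

theory Defs
  imports "HOL-Analysis.Analysis" "HOL-Library.Multiset" "HOL-Library.Landau_Symbols"
begin

text \<open>
  A partition is represented by the multiset of its (positive) parts.
  \<open>box_partitions n l m\<close> consists of the partitions of \<open>n\<close> with largest part at most \<open>l\<close>
  and at most \<open>m\<close> parts; \<open>num_box_partitions n l m\<close> is \<open>N\<^sub>n(l, m)\<close>.
\<close>

definition box_partitions :: "nat \<Rightarrow> nat \<Rightarrow> nat \<Rightarrow> nat multiset set" where
  "box_partitions n l m =
     {p. sum_mset p = n \<and> (\<forall>x\<in>#p. 0 < x \<and> x \<le> l) \<and> size p \<le> m}"

definition num_box_partitions :: "nat \<Rightarrow> nat \<Rightarrow> nat \<Rightarrow> nat" where
  "num_box_partitions n l m = card (box_partitions n l m)"

definition is_parameter_pair :: "real \<Rightarrow> real \<Rightarrow> real \<Rightarrow> real \<Rightarrow> bool" where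
  "is_parameter_pair A B c d \<longleftrightarrow>
     c > 0 \<and> d > 0 \<and>
     A = integral {0..1} (\<lambda>t. 1 / (1 - exp (- c - d * t))) - 1 \<and>
     B = integral {0..1} (\<lambda>t. t / (1 - exp (- c - d * t))) - 1 / 2"

text \<open>
  Meaningful for \<open>A \<ge> 2 * B > 0\<close> only: for \<open>A > 2 * B > 0\<close> there is exactly one parameter
  pair with positive entries, and the case \<open>A = 2 * B\<close> is fixed by convention.
\<close>

definition parameter_pair :: "real \<Rightarrow> real \<Rightarrow> real \<times> real" where
  "parameter_pair A B =
     (if A = 2 * B then (ln ((A + 1) / A), 0)
      else (THE p. is_parameter_pair A B (fst p) (snd p)))"

definition parameter_d :: "real \<Rightarrow> real \<Rightarrow> real" where
  "parameter_d A B = snd (parameter_pair A B)"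

end

theory Submission
  imports Defs
begin

text \<open>
  A partition with at most \<open>m\<close> parts, each at most \<open>l\<close>, is a vector of gaps
  \<open>x\<^sub>0, \<dots>, x\<^sub>m\<close> with \<open>\<Sum> x\<^sub>j = l\<close>, and it is a partition of
  \<open>n = \<Sum> j x\<^sub>j\<close>. Let the gaps be independent and geometric with parameters
  \<open>q\<^sub>j = exp (- c - d j / m)\<close>. Then \<open>N\<^sub>n(l, m)\<close> equals \<open>exp (c l + d n / m)\<close>
  times a constant independent of \<open>n\<close> times the probability of the two sums being \<open>(l, n)\<close>,
  and the equations for \<open>(c, d)\<close> say that the means of the sums are
  \<open>l + O(1)\<close> and \<open>n + O(m)\<close>. Fourier inversion and a comparison with the Gaussian
  bound this probability below by a multiple of \<open>m\<^sup>-\<^sup>2\<close>, and its change when \<open>n\<close> increases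
  by one by a multiple of \<open>m\<^sup>-\<^sup>4\<close>: the Gaussian is even and real, so only the imaginary part
  of the error meets the first-order factor. Hence
  \<open>N\<^sub>n\<^sub>+\<^sub>1 - N\<^sub>n = N\<^sub>n (exp (d / m) - 1 + O(m\<^sup>-\<^sup>2))\<close>, and \<open>d\<close> dominates \<open>1 / m\<close>
  since \<open>A / 2 - B = O(d)\<close> while \<open>m (A / 2 - B) \<longlongrightarrow> \<infinity>\<close>.
\<close>

section \<open>Partitions inside a rectangle\<close>

text \<open>The gap \<open>x\<^sub>j\<close> counts those of the \<open>l\<close> columns of the
  diagram that have height \<open>j\<close>; \<open>x\<^sub>0\<close> counts the empty ones. The
  obstacle is that \<open>d\<close> is bounded above on the compact set but not below: the
  hypotheses only yield that m d tends to infinity. The main term d/m can thus be barely larger than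
  m^(-2), and the relative error must be O(m^(-2)) uniformly in \<open>d\<close>. A local limit
  theorem with relative error m^(-1/2) says nothing about such a difference. At the natural scales a
  ~ m^(-1/2) and t ~ m^(-3/2) the probability has order m^(-2), and bounding exp(-it) - 1 by |t|
  would give m^(-7/2) for its increment. The missing m^(-1/2) is the relative size of the imaginary
  part of the integrand. The limiting covariance is never computed. The Gaussian integral is only
  needed from below, and all constants depend on bounds q0 <= \<open>q\<^sub>j\<close> <= q1 inside
  (0, 1), which follow from bounds on A and B even as d tends to 0.\<close>

definition part_box :: "nat \<Rightarrow> nat \<Rightarrow> nat multiset set" where
  "part_box l m = {p. (\<forall>x\<in>#p. 0 < x \<and> x \<le> l) \<and> size p \<le> m}"

lemma part_box_0 [simp]: "part_box 0 m = {{#}}"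
proof -
  have "p = {#}" if "\<forall>x\<in>#p. 0 < x \<and> x = 0" for p :: "nat multiset"
    using that by (cases p) auto
  then show ?thesis by (auto simp: part_box_def)
qed

lemma part_box_0_right [simp]: "part_box l 0 = {{#}}"
  by (auto simp: part_box_def)

lemma part_box_Suc: "part_box (Suc l) (Suc m) = part_box l (Suc m) \<union> add_mset (Suc l) ` part_box (Suc l) m"
proof (intro equalityI subsetI)
  fix p assume p: "p \<in> part_box (Suc l) (Suc m)"
  show "p \<in> part_box l (Suc m) \<union> add_mset (Suc l) ` part_box (Suc l) m"
  proof (cases "Suc l \<in># p")
    case True
    then obtain q where q: "p = add_mset (Suc l) q" by (metis mset_add)
    with p have "q \<in> part_box (Suc l) m" by (auto simp: part_box_def)
    with q show ?thesis by blast
  next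
    case False
    then have "\<forall>x\<in>#p. x \<noteq> Suc l" by metis
    then have "p \<in> part_box l (Suc m)" using p by (force simp: part_box_def le_Suc_eq)
    then show ?thesis by blast
  qed
qed (auto simp: part_box_def le_Suc_eq)

lemma finite_part_box: "finite (part_box l m)"
proof (induction "l + m" arbitrary: l m rule: less_induct)
  case less
  show ?case
  proof (cases l; cases m)
    fix l' m' assume "l = Suc l'" "m = Suc m'"
    then show ?thesis using less[of l' m] less[of l m'] by (simp add: part_box_Suc)
  qed auto
qed

text \<open>The Gaussian binomial coefficient [l + m choose m] in the variable \<open>x\<close>. The
  variable is complex because the polynomial is evaluated on circles.\<close>

definition box_poly :: "nat \<Rightarrow> nat \<Rightarrow> complex \<Rightarrow> complex" where
  "box_poly l m x = (\<Sum>p\<in>part_box l m. x ^ sum_mset p)"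

lemma box_poly_0 [simp]: "box_poly 0 m x = 1" "box_poly l 0 x = 1"
  by (simp_all add: box_poly_def)

text \<open>One q-Pascal rule: either no part equals \<open>Suc l\<close>, or one such part can be
  removed.\<close>

lemma box_poly_Suc:
  "box_poly (Suc l) (Suc m) x = box_poly l (Suc m) x + x ^ Suc l * box_poly (Suc l) m x"
proof -
  have disj: "part_box l (Suc m) \<inter> add_mset (Suc l) ` part_box (Suc l) m = {}"
    by (auto simp: part_box_def)
  have "(\<Sum>p\<in>add_mset (Suc l) ` part_box (Suc l) m. x ^ sum_mset p)
      = x ^ Suc l * box_poly (Suc l) m x"
    by (subst sum.reindex) (auto simp: inj_on_def box_poly_def sum_distrib_left power_add mult.assoc)
  then show ?thesis
    unfolding box_poly_def part_box_Suc
    by (subst sum.union_disjoint) (use disj finite_part_box in \<open>auto simp: box_poly_def\<close>)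
qed

text \<open>The other q-Pascal rule. Combinatorially it splits off the partitions with exactly
  \<open>Suc m\<close> parts and lowers each part by one; here it is derived from
  \<open>box_poly_Suc\<close> by induction, without a bijection. This form matches
  \<open>fourier_prod_Suc\<close>, where a new factor raises \<open>m\<close>.\<close>

lemma box_poly_Suc':
  "box_poly (Suc l) (Suc m) x = box_poly (Suc l) m x + x ^ Suc m * box_poly l (Suc m) x"
proof (induction "l + m" arbitrary: l m rule: less_induct)
  case less
  show ?case
  proof (cases l; cases m)
    assume "l = 0" "m = 0"
    then show ?thesis by (simp add: box_poly_Suc)
  next
    fix m' assume [simp]: "l = 0" "m = Suc m'"
    have "box_poly (Suc 0) (Suc m) x = 1 + x * box_poly (Suc 0) m x" by (simp add: box_poly_Suc)
    also have "\<dots> = 1 + x * (box_poly (Suc 0) m' x + x ^ m)"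
      using less[of 0 m'] by simp
    also have "\<dots> = box_poly (Suc 0) m x + x ^ Suc m"
      by (simp add: box_poly_Suc algebra_simps)
    finally show ?thesis by simp
  next
    fix l' assume [simp]: "l = Suc l'" "m = 0"
    have "box_poly (Suc l) (Suc 0) x = box_poly l (Suc 0) x + x ^ Suc l"
      by (simp add: box_poly_Suc)
    also have "box_poly l (Suc 0) x = 1 + x * box_poly l' (Suc 0) x"
      using less[of l' 0] by simp
    also have "\<dots> + x ^ Suc l = 1 + x * box_poly l (Suc 0) x"
      by (simp add: box_poly_Suc algebra_simps)
    finally show ?thesis by simp
  next
    fix l' m' assume [simp]: "l = Suc l'" "m = Suc m'"
    have "box_poly (Suc l) (Suc m) x = box_poly l (Suc m) x + x ^ Suc l * box_poly (Suc l) m x"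
      by (rule box_poly_Suc)
    also have "box_poly l (Suc m) x = box_poly l m x + x ^ Suc m * box_poly l' (Suc m) x"
      using less[of l' m] by simp
    also have "box_poly (Suc l) m x = box_poly (Suc l) m' x + x ^ m * box_poly l m x"
      using less[of l m'] by simp
    also have "box_poly l m x + x ^ Suc m * box_poly l' (Suc m) x
        + x ^ Suc l * (box_poly (Suc l) m' x + x ^ m * box_poly l m x)
      = (box_poly l m x + x ^ Suc l * box_poly (Suc l) m' x)
        + x ^ Suc m * (box_poly l' (Suc m) x + x ^ l * box_poly l m x)"
      by (simp add: algebra_simps power_add)
    also have "\<dots> = box_poly (Suc l) m x + x ^ Suc m * box_poly l (Suc m) x"
      using box_poly_Suc[of l m' x] box_poly_Suc[of l' m x] by simp
    finally show ?thesis .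
  qed
qed

section \<open>Fourier inversion\<close>

text \<open>For |z_j| < 1 this is 2 pi times the coefficient of w^k in the product of the 1 / (1 -
  z_j w), that is, the complete homogeneous symmetric polynomial h_k. The index is an integer
  because the recursion is followed into negative degrees.\<close>

definition fourier_prod :: "(nat \<Rightarrow> complex) \<Rightarrow> nat \<Rightarrow> int \<Rightarrow> complex" where
  "fourier_prod z M k =
     integral {-pi..pi} (\<lambda>a. (\<Prod>j<M. 1 / (1 - z j * cis a)) * cis (- of_int k * a))"

lemma integral_cis_int:
  "integral {-pi..pi} (\<lambda>a. cis (of_int k * a)) = (if k = 0 then 2 * pi else 0)"
proof (cases "k = 0")
  case False
  have "((\<lambda>a. cis (of_int k * a)) has_integral
      cis (of_int k * pi) / (\<i> * of_int k) - cis (of_int k * (- pi)) / (\<i> * of_int k)) {-pi..pi}"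
  proof (rule fundamental_theorem_of_calculus)
    fix a :: real
    have "((\<lambda>a. exp (\<i> * of_int k * of_real a) / (\<i> * of_int k)) has_vector_derivative
      exp (\<i> * of_int k * of_real a)) (at a within {-pi..pi})"
      by (rule has_vector_derivative_eq_rhs,
          rule has_vector_derivative_real_field,
          (rule derivative_eq_intros refl | use False in simp)+)
    then show "((\<lambda>a. cis (of_int k * a) / (\<i> * of_int k)) has_vector_derivative
      cis (of_int k * a)) (at a within {-pi..pi})"
      by (simp add: cis_conv_exp mult_ac)
  qed simp
  moreover have "cis (of_int k * pi) = cis (of_int k * (- pi))"
    using sin_int_times_real[of k "pi"]
    by (simp add: complex_eq_iff mult.commute sin_integer_2pi) 
  ultimately show ?thesis using False by (simp add: integral_unique)
qed (simp add: scaleR_conv_of_real)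

lemma one_minus_mult_cis_nz: "cmod z < 1 \<Longrightarrow> 1 - z * cis a \<noteq> 0"
  by (metis eq_iff_diff_eq_0 mult.right_neutral norm_cis norm_mult norm_one order_less_irrefl)

lemma continuous_on_cis' [continuous_intros]:
  "continuous_on S f \<Longrightarrow> continuous_on S (\<lambda>x. cis (f x))" 
  unfolding cis_conv_exp by (intro continuous_intros)

lemma integrable_fourier_prod:
  assumes "\<And>j. cmod (z j) < 1"
  shows "(\<lambda>a. (\<Prod>j<M. 1 / (1 - z j * cis a)) * cis (- of_int k * a)) integrable_on {-pi..pi}"
  by (intro integrable_continuous_interval continuous_intros ballI one_minus_mult_cis_nz assms)

text \<open>Multiplying the integrand by \<open>1 - z M * cis a\<close> cancels its last factor, and
  the factor \<open>cis a\<close> shifts \<open>k\<close>. This is the usual recursion of h_k in the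
  number of variables.\<close>

lemma fourier_prod_Suc:
  assumes z: "\<And>j. cmod (z j) < 1"
  shows "fourier_prod z (Suc M) k = z M * fourier_prod z (Suc M) (k - 1) + fourier_prod z M k"
proof -
  let ?P = "\<lambda>M k a. (\<Prod>j<M. 1 / (1 - z j * cis a)) * cis (- of_int k * a)"
  have eq: "?P (Suc M) k a = z M * ?P (Suc M) (k - 1) a + ?P M k a" for a
  proof -
    have "cis (- of_int (k - 1) * a) = cis (- of_int k * a) * cis a"
      by (simp add: cis_mult algebra_simps)
    then show ?thesis
      using one_minus_mult_cis_nz[OF z[of M], of a]
      by (simp add: field_simps)
  qed
  have "integral {-pi..pi} (?P (Suc M) k) = integral {-pi..pi} (\<lambda>a. z M * ?P (Suc M) (k - 1) a + ?P M k a)"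
    unfolding eq ..
  also have "\<dots> = integral {-pi..pi} (\<lambda>a. z M * ?P (Suc M) (k - 1) a) + integral {-pi..pi} (?P M k)"
    by (rule integral_add) (rule integrable_on_mult_right integrable_fourier_prod z)+
  finally show ?thesis by (simp only: fourier_prod_def integral_mult_right)
qed

lemma fourier_prod_0: "fourier_prod z 0 k = (if k = 0 then 2 * pi else 0)"
  using integral_cis_int[of "-k"] by (simp add: fourier_prod_def)

text \<open>The point is uniformity in \<open>k\<close>, which \<open>fourier_prod_neg\<close> needs
  for indices going to minus infinity.\<close>

lemma fourier_prod_bounded:
  assumes "\<And>j. cmod (z j) < 1"
  shows "\<exists>C. \<forall>k. cmod (fourier_prod z M k) \<le> C"
proof -
  let ?f = "\<lambda>a. \<Prod>j<M. 1 / (1 - z j * cis a)"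
  have "continuous_on {-pi..pi} ?f"
    by (intro continuous_intros ballI one_minus_mult_cis_nz assms)
  then have "compact (?f ` {-pi..pi})" by (rule compact_continuous_image) simp
  then have "bounded (?f ` {-pi..pi})" by (rule compact_imp_bounded)
  then obtain C where C: "\<forall>w\<in>?f ` {-pi..pi}. cmod w \<le> C"
    unfolding bounded_iff by blast
  then have C: "cmod (?f a) \<le> C" if "a \<in> {-pi..pi}" for a
    using that by blast
  have "cmod (fourier_prod z M k) \<le> C * (pi - (- pi))" for k
    unfolding fourier_prod_def
    by (rule integral_bound) (auto intro!: continuous_intros one_minus_mult_cis_nz assms C simp: norm_mult)
  then show ?thesis by blast
qed

text \<open>Takes the place of a geometric series expansion. By induction the term with fewer
  factors vanishes, so each step to the left costs one factor \<open>z M\<close>; boundedness and |z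
  M| < 1 then force the value 0.\<close>

lemma fourier_prod_neg:
  assumes z: "\<And>j. cmod (z j) < 1" and k: "k < 0"
  shows "fourier_prod z M k = 0"
  using k
proof (induction M arbitrary: k)
  case (Suc M)
  note IH = Suc.IH and k = Suc.prems
  have *: "fourier_prod z (Suc M) k = z M ^ N * fourier_prod z (Suc M) (k - int N)" for N
  proof (induction N)
    case (Suc N)
    have "fourier_prod z (Suc M) (k - int N) = z M * fourier_prod z (Suc M) (k - int (Suc N))"
      using fourier_prod_Suc[of z M "k - int N", OF z] IH[of "k - int N"] k by (simp add: algebra_simps)
    then show ?case using Suc by (simp add: mult_ac)
  qed simp
  obtain C where C: "\<And>k. cmod (fourier_prod z (Suc M) k) \<le> C"
    using fourier_prod_bounded[of z "Suc M", OF z] by blast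
  have "cmod (fourier_prod z (Suc M) k) \<le> cmod (z M) ^ N * C" for N
  proof -
    have "cmod (fourier_prod z (Suc M) k) = cmod (z M) ^ N * cmod (fourier_prod z (Suc M) (k - int N))"
      using arg_cong[OF *[of N], of cmod] by (simp only: norm_mult norm_power)
    then show ?thesis using C by (simp add: mult_left_mono)
  qed
  moreover have "(\<lambda>N. cmod (z M) ^ N * C) \<longlonglongrightarrow> 0 * C"
    by (rule tendsto_mult[OF LIMSEQ_power_zero tendsto_const]) (use z in simp)
  ultimately have "cmod (fourier_prod z (Suc M) k) \<le> 0 * C"
    by (intro LIMSEQ_le_const[where X = "\<lambda>N. cmod (z M) ^ N * C"]) blast+
  then show ?case by simp
qed (simp add: fourier_prod_0)

lemma fourier_prod_zero:
  assumes z: "\<And>j. cmod (z j) < 1"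
  shows "fourier_prod z M 0 = 2 * pi"
proof (induction M)
  case (Suc M)
  then show ?case
    using fourier_prod_Suc[of z M 0, OF z] fourier_prod_neg[of z "-1" "Suc M", OF z] by simp
qed (simp add: fourier_prod_0)

text \<open>An exponent vector of total degree \<open>l\<close> in y, y x, ..., y x^m is the gap
  vector of a partition in the box, so h_l of these variables is y^l times the Gaussian binomial.
  The proof compares the recursions \<open>fourier_prod_Suc\<close> and
  \<open>box_poly_Suc'\<close>.\<close>

lemma fourier_prod_geometric:
  fixes x y :: complex
  assumes y: "cmod y < 1" and x: "cmod x \<le> 1"
  shows "fourier_prod (\<lambda>j. y * x ^ j) (Suc m) (int l) = 2 * pi * y ^ l * box_poly l m x"
proof -
  define z where "z = (\<lambda>j. y * x ^ j)"
  have z: "cmod (z j) < 1" for j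
  proof -
    have "cmod (z j) \<le> cmod y * 1"
      unfolding z_def norm_mult norm_power by (intro mult_left_mono power_le_one x) auto
    then show ?thesis using y by simp
  qed
  have "fourier_prod z (Suc m) (int l) = 2 * pi * y ^ l * box_poly l m x"
  proof (induction m arbitrary: l)
    case 0
    show ?case
    proof (induction l)
      case 0
      then show ?case by (simp add: fourier_prod_zero[OF z])
    next
      case (Suc l)
      have "fourier_prod z (Suc 0) (int (Suc l)) =
         z 0 * fourier_prod z (Suc 0) (int l) + fourier_prod z 0 (int (Suc l))"
        using fourier_prod_Suc[of z 0 "int (Suc l)", OF z] by simp
      then show ?case unfolding Suc by (simp add: z_def fourier_prod_0)
    qed
  next
    case (Suc m)
    note IH = this
    show ?case
    proof (induction l)
      case 0
      then show ?case by (simp add: fourier_prod_zero[OF z])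
    next
      case (Suc l)
      have "fourier_prod z (Suc (Suc m)) (int (Suc l)) =
         z (Suc m) * fourier_prod z (Suc (Suc m)) (int l) + fourier_prod z (Suc m) (int (Suc l))"
        using fourier_prod_Suc[of z "Suc m" "int (Suc l)", OF z] by simp
      then show ?case unfolding IH Suc by (simp add: z_def box_poly_Suc' algebra_simps)
    qed
  qed
  then show ?thesis by (simp add: z_def)
qed

lemma has_integral_power_cis:
  "((\<lambda>t. (complex_of_real r * cis t) ^ k * cis (- real n * t)) has_integral
      (if k = n then 2 * pi * complex_of_real r ^ n else 0)) {-pi..pi}"
proof -
  have eq: "(complex_of_real r * cis t) ^ k * cis (- real n * t)
    = complex_of_real r ^ k * cis (of_int (int k - int n) * t)" for t
  proof -
    have "cis (of_int (int k - int n) * t) = cis (real k * t) * cis (- real n * t)"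
      unfolding cis_mult by (simp add: left_diff_distrib)
    then show ?thesis by (simp only: power_mult_distrib Complex.DeMoivre mult.assoc)
  qed
  have "(\<lambda>t. cis (of_int (int k - int n) * t)) integrable_on {-pi..pi}"
    by (intro integrable_continuous_interval continuous_intros)
  then have "((\<lambda>t. cis (of_int (int k - int n) * t)) has_integral
    (if k = n then 2 * pi else 0)) {-pi..pi}"
    using integral_cis_int[of "int k - int n"]
    by (simp add: has_integral_integrable_integral)
  from has_integral_mult_right[OF this, of "complex_of_real r ^ k"]
  show ?thesis unfolding eq by (auto simp: mult_ac)
qed

lemma integral_box_poly:
  "integral {-pi..pi} (\<lambda>t. box_poly l m (complex_of_real r * cis t) * cis (- real n * t))
     = 2 * pi * r ^ n * num_box_partitions n l m"
proof -
  have "((\<lambda>t. \<Sum>p\<in>part_box l m. (complex_of_real r * cis t) ^ sum_mset p * cis (- real n * t)) has_integral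
      (\<Sum>p\<in>part_box l m. if sum_mset p = n then 2 * pi * complex_of_real r ^ n else 0)) {-pi..pi}"
    by (intro has_integral_sum finite_part_box has_integral_power_cis)
  moreover have "{p \<in> part_box l m. sum_mset p = n} = box_partitions n l m"
    by (auto simp: part_box_def box_partitions_def)
  then have "(\<Sum>p\<in>part_box l m. if sum_mset p = n then 2 * pi * complex_of_real r ^ n else 0)
     = 2 * pi * r ^ n * num_box_partitions n l m"
    by (simp add: sum.If_cases finite_part_box Collect_conj_eq[symmetric] num_box_partitions_def Int_def)
  ultimately show ?thesis
    by (simp add: box_poly_def sum_distrib_right integral_unique)
qed

text \<open>Characteristic function at \<open>b\<close> of the law P(X = k) = (1 - q) q^k, k >=
  0.\<close>

definition geometric_char :: "real \<Rightarrow> real \<Rightarrow> complex" where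
  "geometric_char q b = of_real (1 - q) / (1 - of_real q * cis b)"

lemma continuous_on_geometric_char [continuous_intros]:
  assumes "continuous_on S f" "0 \<le> q" "q < 1"
  shows "continuous_on S (\<lambda>x. geometric_char q (f x))"
  unfolding geometric_char_def
  by (intro continuous_intros assms ballI one_minus_mult_cis_nz) (use assms in auto)

text \<open>For independent geometric X_j with parameters y r^j, both sides are 4 pi^2 times the
  probability that the X_j sum to \<open>l\<close> and the j X_j sum to \<open>n\<close>: every gap
  vector of a partition of \<open>n\<close> has the same weight. The inner integral over
  \<open>a\<close> fixes \<open>l\<close>, the outer one over \<open>t\<close> fixes
  \<open>n\<close>.\<close>

lemma integral_geometric_char_prod:
  fixes y r :: real
  assumes y: "0 < y" "y < 1" and r: "0 < r" "r \<le> 1"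
  shows "integral (cbox (-pi, -pi) (pi, pi))
      (\<lambda>(t, a). (\<Prod>j<Suc m. geometric_char (y * r ^ j) (a + j * t)) * cis (- (l * a + n * t)))
    = of_real (4 * pi\<^sup>2 * (\<Prod>j<Suc m. 1 - y * r ^ j) * y ^ l * r ^ n * num_box_partitions n l m)"
proof -
  let ?x = "\<lambda>t. complex_of_real r * cis t"
  let ?F = "\<lambda>(t::real, a::real). (\<Prod>j<Suc m. geometric_char (y * r ^ j) (a + j * t)) * cis (- (l * a + n * t))"
  define W where "W = complex_of_real (\<Prod>j<Suc m. 1 - y * r ^ j)"
  have q: "0 \<le> y * r ^ j" "y * r ^ j < 1" for j
  proof -
    have "y * r ^ j \<le> y * 1" using y r by (intro mult_left_mono power_le_one) auto
    then show "y * r ^ j < 1" using y by linarith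
    show "0 \<le> y * r ^ j" using y r by simp
  qed
  have "continuous_on (cbox (-pi, -pi) (pi, pi)) ?F"
    unfolding case_prod_unfold by (intro continuous_intros q)
  then have "integral (cbox (-pi, -pi) (pi, pi)) ?F
      = integral {-pi..pi} (\<lambda>t. integral {-pi..pi} (\<lambda>a. ?F (t, a)))"
    by (subst integral_prod_continuous) simp_all
  also have "(\<lambda>t. integral {-pi..pi} (\<lambda>a. ?F (t, a)))
      = (\<lambda>t. W * complex_of_real (2 * pi) * complex_of_real y ^ l * (box_poly l m (?x t) * cis (- real n * t)))"
  proof
    fix t
    have "?F (t, a) = W * cis (- real n * t) * ((\<Prod>j<Suc m. 1 / (1 - of_real y * ?x t ^ j * cis a))
        * cis (- of_int (int l) * a))" for a
    proof -
      have "geometric_char (y * r ^ j) (a + j * t)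
        = of_real (1 - y * r ^ j) * (1 / (1 - of_real y * ?x t ^ j * cis a))" for j
        by (simp add: geometric_char_def power_mult_distrib Complex.DeMoivre cis_mult[symmetric] mult_ac)
      moreover have "cis (- (l * a + n * t)) = cis (- real n * t) * cis (- of_int (int l) * a)"
        unfolding cis_mult by (simp add: algebra_simps)
      ultimately show ?thesis
        by (simp only: prod.distrib W_def of_real_prod prod.case mult_ac)
    qed
    then have "integral {-pi..pi} (\<lambda>a. ?F (t, a))
      = W * cis (- real n * t) * fourier_prod (\<lambda>j. of_real y * ?x t ^ j) (Suc m) (int l)"
      by (simp only: fourier_prod_def integral_mult_right)
    also have "fourier_prod (\<lambda>j. of_real y * ?x t ^ j) (Suc m) (int l) = complex_of_real (2 * pi) * complex_of_real y ^ l * box_poly l m (?x t)"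
      by (rule fourier_prod_geometric) (use y r in \<open>auto simp: norm_mult\<close>)
    finally show "integral {-pi..pi} (\<lambda>a. ?F (t, a))
      = W * complex_of_real (2 * pi) * complex_of_real y ^ l * (box_poly l m (?x t) * cis (- real n * t))"
      by (simp only: mult_ac of_real_mult)
  qed
  also have "integral {-pi..pi} \<dots> = W * complex_of_real (2 * pi) * complex_of_real y ^ l * (2 * pi * r ^ n * num_box_partitions n l m)"
    unfolding integral_mult_right integral_box_poly ..
  finally show ?thesis
    by (simp add: W_def power2_eq_square)
qed

section \<open>Characteristic functions of geometric variables\<close>

lemma half_abs_le_abs_sin:
  fixes x :: real
  assumes "\<bar>x\<bar> \<le> pi / 2"
  shows "\<bar>x\<bar> / 2 \<le> \<bar>sin x\<bar>"
proof -
  have "\<bar>sin x - (\<Sum>k<3. sin_coeff k * x ^ k)\<bar> \<le> inverse (fact 3) * \<bar>x\<bar> ^ 3"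
    by (rule Maclaurin_sin_bound)
  moreover have "(\<Sum>k<3. sin_coeff k * x ^ k) = x"
    by (simp add: numeral_3_eq_3 sin_coeff_def)
  ultimately have *: "\<bar>sin x - x\<bar> \<le> \<bar>x\<bar> ^ 3 / 6"
    by (simp add: fact_numeral)
  \<comment> \<open>Since pi/2 <= 8/5 and (8/5)^2 <= 3, the cubic remainder is at most half of
    |x|.\<close>
  have "\<bar>x\<bar> \<le> 8 / 5" using assms pi_less_4 pi_approx by simp
  then have "\<bar>x\<bar> ^ 2 \<le> (8 / 5) ^ 2" by (intro power_mono) auto
  then have "\<bar>x\<bar> * \<bar>x\<bar> ^ 2 \<le> \<bar>x\<bar> * 3"
    by (intro mult_left_mono) (auto simp: power2_eq_square)
  then have "\<bar>x\<bar> ^ 3 / 6 \<le> \<bar>x\<bar> / 2" by (simp add: power3_eq_cube power2_eq_square)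
  with * show ?thesis by linarith
qed

lemma sin_squared_ge:
  fixes x :: real
  assumes "\<bar>x\<bar> \<le> pi / 2"
  shows "x\<^sup>2 / 4 \<le> (sin x)\<^sup>2"
  using power_mono[OF half_abs_le_abs_sin[OF assms], of 2] by (simp add: power_divide)

lemma sin_add_squared_le:
  fixes x y :: real
  shows "(sin (x + y))\<^sup>2 \<le> 2 * (sin x)\<^sup>2 + 2 * (sin y)\<^sup>2"
proof -
  have "\<bar>sin (x + y)\<bar> \<le> \<bar>sin x * cos y\<bar> + \<bar>cos x * sin y\<bar>"
    unfolding sin_add by (rule abs_triangle_ineq)
  also have "\<dots> \<le> \<bar>sin x\<bar> * 1 + 1 * \<bar>sin y\<bar>"
    unfolding abs_mult by (intro add_mono mult_mono) auto
  finally have "\<bar>sin (x + y)\<bar>\<^sup>2 \<le> (\<bar>sin x\<bar> + \<bar>sin y\<bar>)\<^sup>2"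
    by (intro power_mono) auto
  moreover have "(\<bar>sin x\<bar> + \<bar>sin y\<bar>)\<^sup>2 \<le> 2 * \<bar>sin x\<bar>\<^sup>2 + 2 * \<bar>sin y\<bar>\<^sup>2"
    using zero_le_power2[of "\<bar>sin x\<bar> - \<bar>sin y\<bar>"] by (simp add: power2_eq_square algebra_simps)
  ultimately show ?thesis by simp
qed

text \<open>The angles of the terms \<open>j\<close> and \<open>j + k\<close> differ by k t / 2, so
  \<open>a\<close> drops out and the two terms together control sin(k t / 2). At least m/2 such
  pairs exist, and each term occurs in at most two of them.\<close>

lemma sum_sin_squared_ge_increment:
  fixes a t :: real and k m :: nat
  assumes "2 * k \<le> m"
  shows "m * (sin (k * t / 2))\<^sup>2 / 8 \<le> (\<Sum>j<Suc m. (sin ((a + j * t) / 2))\<^sup>2)" (is "_ \<le> ?S")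
proof -
  let ?s = "\<lambda>j. (sin ((a + real j * t) / 2))\<^sup>2"
  have "(sin (k * t / 2))\<^sup>2 \<le> 2 * ?s (j + k) + 2 * ?s j" for j
    using sin_add_squared_le[of "(a + real (j + k) * t) / 2" "- ((a + real j * t) / 2)"]
    by (simp add: field_simps)
  then have "(\<Sum>j<Suc m - k. (sin (k * t / 2))\<^sup>2) \<le> (\<Sum>j<Suc m - k. 2 * ?s (j + k) + 2 * ?s j)"
    by (intro sum_mono) auto
  also have "\<dots> = 2 * (\<Sum>j<Suc m - k. ?s (j + k)) + 2 * (\<Sum>j<Suc m - k. ?s j)"
    by (simp add: sum.distrib sum_distrib_left)
  also have "(\<Sum>j<Suc m - k. ?s (j + k)) = (\<Sum>j\<in>(\<lambda>j. j + k) ` {..<Suc m - k}. ?s j)"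
    by (subst sum.reindex) auto
  also have "\<dots> \<le> ?S"
    using assms by (intro sum_mono2) auto
  also have "(\<Sum>j<Suc m - k. ?s j) \<le> ?S"
    by (intro sum_mono2) auto
  finally have "real (Suc m - k) * (sin (k * t / 2))\<^sup>2 \<le> 4 * ?S"
    by simp
  moreover have "real m / 2 * (sin (k * t / 2))\<^sup>2 \<le> real (Suc m - k) * (sin (k * t / 2))\<^sup>2"
    using assms by (intro mult_right_mono) auto
  ultimately show ?thesis by simp
qed

text \<open>The angle a/2 is (a + j t)/2 minus j t/2, and for j <= m/2 the latter is controlled by
  \<open>sum_sin_squared_ge_increment\<close> with k = j. Summing over N >= m/2 such
  \<open>j\<close> gives 18 times the sum, and sin(a/2)^2 >= a^2/16, whence 576 = 18 * 2 *
  16.\<close>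

lemma sum_sin_squared_ge_initial:
  fixes a t :: real
  assumes "1 \<le> m" "\<bar>a\<bar> \<le> pi"
  shows "m * a\<^sup>2 / 576 \<le> (\<Sum>j<Suc m. (sin ((a + j * t) / 2))\<^sup>2)" (is "_ \<le> ?S")
proof -
  define N where "N = Suc (m div 2)"
  have N: "m / 2 \<le> N" "N \<le> m" unfolding N_def using assms(1) by linarith+
  have "(sin (a / 2))\<^sup>2 \<le> 2 * (sin ((a + real j * t) / 2))\<^sup>2 + 16 * ?S / m" if "j < N" for j
  proof -
    have "2 * j \<le> m" using that unfolding N_def by linarith
    from sum_sin_squared_ge_increment[OF this, of t a] assms(1)
    have "(sin (j * t / 2))\<^sup>2 \<le> 8 * ?S / m" by (simp add: field_simps)
    moreover have "(sin (a / 2))\<^sup>2 \<le> 2 * (sin ((a + real j * t) / 2))\<^sup>2 + 2 * (sin (j * t / 2))\<^sup>2"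
      using sin_add_squared_le[of "(a + real j * t) / 2" "- (j * t / 2)"] by (simp add: field_simps)
    ultimately show ?thesis by linarith
  qed
  then have "(\<Sum>j<N. (sin (a / 2))\<^sup>2) \<le> (\<Sum>j<N. 2 * (sin ((a + real j * t) / 2))\<^sup>2 + 16 * ?S / m)"
    by (intro sum_mono) auto
  also have "\<dots> = 2 * (\<Sum>j<N. (sin ((a + real j * t) / 2))\<^sup>2) + real N * (16 * ?S / m)"
    by (simp add: sum.distrib sum_distrib_left)
  also have "(\<Sum>j<N. (sin ((a + real j * t) / 2))\<^sup>2) \<le> ?S"
    using N by (intro sum_mono2) auto
  also have "real N * (16 * ?S / m) \<le> real m * (16 * ?S / m)"
    using N by (intro mult_right_mono divide_nonneg_nonneg mult_nonneg_nonneg sum_nonneg) auto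
  also have "real m * (16 * ?S / m) = 16 * ?S" using assms by simp
  finally have "N * (sin (a / 2))\<^sup>2 \<le> 18 * ?S" by simp
  moreover have "m / 2 * ((a / 2)\<^sup>2 / 4) \<le> N * (sin (a / 2))\<^sup>2"
    using assms by (intro mult_mono N sin_squared_ge) auto
  ultimately show ?thesis by (simp add: power_divide)
qed

text \<open>One wants k <= m/2 with k |t| / 2 as large as possible below pi/2, where the sine is
  comparable to its argument. If m |t| <= 2 pi, take k = m div 2 >= m/3, whence 144 = 16 * 9.
  Otherwise floor(pi / |t|) is below m/2 and brings k |t| between pi/2 and pi.\<close>

lemma exists_multiple_sin_squared_ge:
  fixes t :: real and m :: nat
  assumes m: "2 \<le> m" and t: "\<bar>t\<bar> \<le> pi"
  shows "\<exists>k. 2 * k \<le> m \<and> min 1 ((real m)\<^sup>2 * t\<^sup>2) / 144 \<le> (sin (real k * t / 2))\<^sup>2"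
proof (cases "m * \<bar>t\<bar> \<le> 2 * pi")
  case True
  define k where "k = m div 2"
  have k: "2 * k \<le> m" "m / 3 \<le> k"
  proof -
    have "m \<le> 3 * k" unfolding k_def using m by presburger
    then show "m / 3 \<le> k" by linarith
  qed (simp add: k_def)
  have "\<bar>real k * t / 2\<bar> \<le> pi / 2"
  proof -
    have "2 * real k * \<bar>t\<bar> \<le> m * \<bar>t\<bar>" using k by (intro mult_right_mono) auto
    then show ?thesis using True by (simp add: abs_mult)
  qed
  from sin_squared_ge[OF this] have "(k * t)\<^sup>2 / 16 \<le> (sin (real k * t / 2))\<^sup>2"
    by (simp add: power_divide)
  moreover have "(m / 3)\<^sup>2 * t\<^sup>2 \<le> (real k)\<^sup>2 * t\<^sup>2"
    using k by (intro mult_right_mono power_mono) auto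
  ultimately have "(real m)\<^sup>2 * t\<^sup>2 / 144 \<le> (sin (real k * t / 2))\<^sup>2"
    by (simp add: power_divide power_mult_distrib)
  then show ?thesis using k by (intro exI[of _ k]) (auto simp: min_def)
next
  case False
  then have t0: "\<bar>t\<bar> > 0" by auto
  define k where "k = nat \<lfloor>pi / \<bar>t\<bar>\<rfloor>"
  have ge1: "1 \<le> pi / \<bar>t\<bar>" using t t0 by simp
  then have k: "1 \<le> k" "k \<le> pi / \<bar>t\<bar>" "pi / \<bar>t\<bar> < k + 1" unfolding k_def by linarith+
  have "pi / \<bar>t\<bar> < m / 2" using False t0 by (simp add: field_simps)
  with k have km: "2 * k \<le> m" by linarith
  have "real k * \<bar>t\<bar> \<le> pi" using k(2) t0 by (simp add: field_simps)
  then have le: "\<bar>real k * t / 2\<bar> \<le> pi / 2" by (simp add: abs_mult)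
  have "pi \<le> 2 * real k * \<bar>t\<bar>"
  proof -
    have "pi < (k + 1) * \<bar>t\<bar>" using k(3) t0 by (simp add: field_simps)
    also have "\<dots> \<le> (2 * real k) * \<bar>t\<bar>" using k(1) by (intro mult_right_mono) auto
    finally show ?thesis by simp
  qed
  then have "3 / 4 \<le> \<bar>real k * t / 2\<bar>" using pi_gt3 by (simp add: abs_mult)
  then have "(3 / 4)\<^sup>2 \<le> \<bar>real k * t / 2\<bar>\<^sup>2" by (intro power_mono) auto
  with sin_squared_ge[OF le] have "1 / 144 \<le> (sin (real k * t / 2))\<^sup>2"
    unfolding power2_abs by (simp add: power2_eq_square)
  then show ?thesis using km by (intro exI[of _ k]) auto
qed

lemma sum_sin_squared_ge:
  fixes a t :: real
  assumes "2 \<le> m" "\<bar>a\<bar> \<le> pi" "\<bar>t\<bar> \<le> pi"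
  shows "m * (a\<^sup>2 + min 1 ((real m)\<^sup>2 * t\<^sup>2)) / 2304 \<le> (\<Sum>j<Suc m. (sin ((a + j * t) / 2))\<^sup>2)"
proof -
  obtain k where k: "2 * k \<le> m" "min 1 ((real m)\<^sup>2 * t\<^sup>2) / 144 \<le> (sin (real k * t / 2))\<^sup>2"
    using exists_multiple_sin_squared_ge assms by blast
  define S where "S = (\<Sum>j<Suc m. (sin ((a + j * t) / 2))\<^sup>2)"
  have "m * (min 1 ((real m)\<^sup>2 * t\<^sup>2) / 144) \<le> m * (sin (real k * t / 2))\<^sup>2"
    using k by (intro mult_left_mono) auto
  also have "\<dots> \<le> 8 * S"
    using sum_sin_squared_ge_increment[OF k(1), of t a] by (simp add: S_def)
  finally have "m * min 1 ((real m)\<^sup>2 * t\<^sup>2) \<le> 1152 * S" by simp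
  moreover have "m * a\<^sup>2 \<le> 576 * S"
    using sum_sin_squared_ge_initial[of m a t] assms by (simp add: S_def)
  moreover have "0 \<le> S" by (simp add: S_def sum_nonneg)
  ultimately have "m * (a\<^sup>2 + min 1 ((real m)\<^sup>2 * t\<^sup>2)) \<le> 2304 * S"
    unfolding distrib_left by linarith
  then show ?thesis unfolding S_def by linarith
qed

section \<open>Decay and Gaussian approximation of a single factor\<close>

text \<open>With s = sin(b/2)^2 the squared modulus is (1 - q)^2 / ((1 - q)^2 + 4 q s), which is at
  most 1 / (1 + 4 q0 s) because (1 - q)^2 <= 1 and q >= q0.\<close>

lemma norm_geometric_char_le:
  assumes "0 < q0" "q0 \<le> q" "q < 1"
  shows "cmod (geometric_char q b) \<le> exp (- (2 * q0 / (1 + 4 * q0)) * (sin (b / 2))\<^sup>2)"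
proof -
  define s where "s = (sin (b / 2))\<^sup>2"
  \<comment> \<open>\<open>1 - u\<close> is the chord over [0, 1] of the convex function s -> 1 / (1
    + 4 q0 s), so it lies above that function, and exp(-u) lies above the chord.\<close>
  define u where "u = 4 * q0 / (1 + 4 * q0) * s"
  have s: "0 \<le> s" "s \<le> 1" by (auto simp: s_def abs_square_le_1)
  have cosb: "cos b = 1 - 2 * s"
    using cos_double_sin[of "b / 2"] by (simp add: s_def)
  have sinb: "(sin b)\<^sup>2 = 4 * s - 4 * s\<^sup>2"
    using sin_cos_squared_add[of b] by (simp add: cosb power2_eq_square algebra_simps)
  have "(cmod (1 - of_real q * cis b))\<^sup>2 = (1 - q * cos b)\<^sup>2 + q\<^sup>2 * (sin b)\<^sup>2"
    by (simp add: cmod_power2 power_mult_distrib)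
  also have "\<dots> = (1 - q)\<^sup>2 + 4 * q * s"
    unfolding cosb sinb by (simp add: power2_eq_square algebra_simps)
  finally have den: "(cmod (1 - of_real q * cis b))\<^sup>2 = (1 - q)\<^sup>2 + 4 * q * s" .
  have "u \<le> 4 * q0 / (1 + 4 * q0) * 1"
    unfolding u_def using s assms by (intro mult_left_mono) auto
  also have "\<dots> < 1" using assms by simp
  finally have u: "u < 1" .
  have "1 - u \<le> exp (- u)" using exp_ge_add_one_self[of "- u"] by simp
  moreover have "1 \<le> (1 + 4 * q0 * s) * (1 - u)"
  proof -
    have "(1 + 4 * q0 * s) * (1 - u) - 1 = (4 * q0)\<^sup>2 * s * (1 - s) / (1 + 4 * q0)"
      unfolding u_def using assms by (simp add: field_simps power2_eq_square)
    moreover have "\<dots> \<ge> 0" using assms s by auto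
    ultimately show ?thesis by linarith
  qed
  ultimately have e: "1 \<le> (1 + 4 * q0 * s) * exp (- u)"
    using s assms by (smt (verit) mult_left_mono mult_nonneg_nonneg)
  have "(1 - q)\<^sup>2 * 1 \<le> (1 - q)\<^sup>2 * ((1 + 4 * q0 * s) * exp (- u))"
    by (intro mult_left_mono e) auto
  also have "\<dots> = ((1 - q)\<^sup>2 + (1 - q)\<^sup>2 * (4 * q0 * s)) * exp (- u)"
    by (simp add: algebra_simps)
  also have "\<dots> \<le> ((1 - q)\<^sup>2 + 1 * (4 * q * s)) * exp (- u)"
    using assms s
    by (intro mult_right_mono add_left_mono mult_mono) (auto simp: power_le_one)
  finally have main: "(1 - q)\<^sup>2 \<le> ((1 - q)\<^sup>2 + 4 * q * s) * exp (- u)" by simp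
  have pos: "(1 - q)\<^sup>2 + 4 * q * s > 0"
    using assms s by (intro add_pos_nonneg) auto
  have "(cmod (geometric_char q b))\<^sup>2 = (1 - q)\<^sup>2 / ((1 - q)\<^sup>2 + 4 * q * s)"
    unfolding geometric_char_def norm_divide power_divide den norm_of_real by simp
  also have "\<dots> \<le> exp (- u)"
    using main pos by (simp add: divide_le_eq mult.commute)
  also have "\<dots> = (exp (- (2 * q0 / (1 + 4 * q0)) * s))\<^sup>2"
    unfolding u_def exp_double[symmetric] by simp
  finally show ?thesis
    unfolding s_def by (rule power2_le_imp_le) simp
qed

text \<open>Since E' = L E and L' = -s, every derivative of \<open>E\<close> is a polynomial in
  \<open>L\<close> times \<open>E\<close>. On the unit disc |L| <= 2 M and |E| <= exp(2 M), so the
  third-order remainder is uniform in \<open>a\<close> and \<open>s\<close>.\<close>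

lemma norm_exp_quadratic_Taylor:
  fixes a s b M :: real
  assumes M: "\<bar>a\<bar> \<le> M" "\<bar>s\<bar> \<le> M" and b: "\<bar>b\<bar> \<le> 1"
  shows "cmod (exp (\<i> * a * b - s * b\<^sup>2 / 2) - (1 + \<i> * a * b - (a\<^sup>2 + s) * b\<^sup>2 / 2))
    \<le> ((2 * M) ^ 3 + 3 * M * (2 * M)) * exp (2 * M) * \<bar>b\<bar> ^ 3"
proof -
  define E where "E = (\<lambda>z :: complex. exp (\<i> * a * z - s * z\<^sup>2 / 2))"
  define L where "L = (\<lambda>z :: complex. \<i> * of_real a - of_real s * z)"
  define f where "f = (\<lambda>i :: nat. if i = 0 then E else if i = 1 then (\<lambda>z. L z * E z)
     else if i = 2 then (\<lambda>z. ((L z)\<^sup>2 - s) * E z) else (\<lambda>z. ((L z) ^ 3 - 3 * s * L z) * E z))"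
  have M0: "0 \<le> M" using M by linarith
  have dE: "(E has_field_derivative L z * E z) (at z within S)" for z S
    unfolding E_def L_def by (rule derivative_eq_intros refl | simp add: algebra_simps)+
  have dL: "(L has_field_derivative - s) (at z within S)" for z S
    unfolding L_def by (rule derivative_eq_intros refl | simp)+
  have d: "(f i has_field_derivative f (Suc i) z) (at z within cball 0 1)" if "i \<le> 2" for i z
  proof -
    from that consider "i = 0" | "i = 1" | "i = 2" by linarith
    then show ?thesis
    proof cases
      case 1 then show ?thesis using dE by (simp add: f_def)
    next
      case 2
      have "((\<lambda>z. L z * E z) has_field_derivative ((L z)\<^sup>2 - s) * E z) (at z within cball 0 1)"
        by (rule DERIV_cong[OF DERIV_mult[OF dL dE]]) (simp add: algebra_simps power2_eq_square)
      then show ?thesis using 2 by (simp add: f_def)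
    next
      case 3
      have "((\<lambda>z. ((L z)\<^sup>2 - s) * E z) has_field_derivative ((L z) ^ 3 - 3 * s * L z) * E z) (at z within cball 0 1)"
        by (rule DERIV_cong[OF DERIV_mult[OF DERIV_diff[OF DERIV_power[OF dL] DERIV_const] dE]])
           (simp add: algebra_simps power2_eq_square power3_eq_cube)
      then show ?thesis using 3 by (simp add: f_def)
    qed
  qed
  have bound: "cmod (f (Suc 2) z) \<le> ((2 * M) ^ 3 + 3 * M * (2 * M)) * exp (2 * M)" if "z \<in> cball 0 1" for z
  proof -
    have z: "cmod z \<le> 1" using that by simp
    have "cmod (L z) \<le> cmod (\<i> * of_real a) + cmod (of_real s * z)"
      unfolding L_def by (rule norm_triangle_ineq4)
    also have "\<dots> \<le> M + M * 1"
      unfolding norm_mult using M z by (intro add_mono mult_mono) auto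
    finally have L: "cmod (L z) \<le> 2 * M" by simp
    have "Re (\<i> * a * z - s * z\<^sup>2 / 2) \<le> cmod (\<i> * a * z - s * z\<^sup>2 / 2)" by (rule complex_Re_le_cmod)
    also have "\<dots> \<le> cmod (\<i> * a * z) + cmod (s * z\<^sup>2 / 2)" by (rule norm_triangle_ineq4)
    also have "\<dots> \<le> M * 1 + M * 1\<^sup>2 / 1"
      unfolding norm_mult norm_divide norm_power norm_of_real norm_ii
      using M M0 z by (intro add_mono frac_le mult_mono power_mono) auto
    finally have E: "cmod (E z) \<le> exp (2 * M)" unfolding E_def by simp
    have "cmod (L z ^ 3 - 3 * s * L z) \<le> cmod (L z ^ 3) + cmod (3 * s * L z)"
      by (rule norm_triangle_ineq4)
    also have "\<dots> \<le> (2 * M) ^ 3 + 3 * M * (2 * M)"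
      unfolding norm_mult norm_power norm_of_real norm_numeral
      using M M0 L by (intro add_mono mult_mono power_mono) auto
    finally have "cmod (L z ^ 3 - 3 * s * L z) * cmod (E z)
        \<le> ((2 * M) ^ 3 + 3 * M * (2 * M)) * exp (2 * M)"
      using E M0 by (intro mult_mono) auto
    then show ?thesis by (simp add: f_def norm_mult)
  qed
  have "cmod (f 0 (of_real b) - (\<Sum>i\<le>2. f i 0 * (of_real b - 0) ^ i / fact i))
      \<le> ((2 * M) ^ 3 + 3 * M * (2 * M)) * exp (2 * M) * cmod (of_real b - 0) ^ Suc 2 / fact 2"
    using d bound b by (intro complex_Taylor[where S = "cball 0 1"]) auto
  also have "(\<Sum>i\<le>2. f i 0 * (of_real b - 0) ^ i / fact i) = 1 + \<i> * a * b - (a\<^sup>2 + s) * b\<^sup>2 / 2"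
    by (simp add: f_def E_def L_def numeral_2_eq_2 fact_numeral power2_eq_square)
       (simp add: algebra_simps power2_eq_square)
  also have "((2 * M) ^ 3 + 3 * M * (2 * M)) * exp (2 * M) * cmod (of_real b - 0) ^ Suc 2 / fact 2
    \<le> ((2 * M) ^ 3 + 3 * M * (2 * M)) * exp (2 * M) * \<bar>b\<bar> ^ 3"
  proof -
    have *: "X * cmod (of_real b - 0) ^ Suc 2 / fact 2 \<le> X * \<bar>b\<bar> ^ 3" if "0 \<le> X" for X
      using mult_nonneg_nonneg[OF that, of "\<bar>b\<bar> ^ 3"] by (simp add: fact_numeral)
    show ?thesis
      by (rule *, intro mult_nonneg_nonneg add_nonneg_nonneg zero_le_power) (use M0 in auto)
  qed
  also have "f 0 (of_real b) = exp (\<i> * a * b - s * b\<^sup>2 / 2)"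
    by (simp add: f_def E_def)
  finally show ?thesis .
qed

definition geom_mean :: "real \<Rightarrow> real" where
  "geom_mean q = q / (1 - q)"

definition geom_var :: "real \<Rightarrow> real" where
  "geom_var q = q / (1 - q)\<^sup>2"

text \<open>The quotient is never expanded. Put E(a) = exp(i a b - s b^2 / 2). Multiplying by the
  denominator leaves 1 - q - (1 - q cis b) E(mu), and cis b E(mu) = E(1 + mu), so Taylor polynomials
  of two exponentials suffice. The denominator has modulus at least 1 - q >= 1 - q1.\<close>

lemma geometric_char_approx:
  assumes q1: "q1 < 1"
  shows "\<exists>C>0. \<forall>q b. 0 \<le> q \<longrightarrow> q \<le> q1 \<longrightarrow>
    cmod (geometric_char q b * cis (- geom_mean q * b) - of_real (exp (- geom_var q * b\<^sup>2 / 2))) \<le> C * \<bar>b\<bar> ^ 3"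
proof -
  define M where "M = 1 / (1 - q1)\<^sup>2"
  define C0 where "C0 = ((2 * M) ^ 3 + 3 * M * (2 * M)) * exp (2 * M)"
  have M0: "M > 0" using q1 by (simp add: M_def)
  then have C0: "C0 > 0" by (auto simp: C0_def intro!: mult_pos_pos add_pos_pos)
  have "cmod (geometric_char q b * cis (- geom_mean q * b) - of_real (exp (- geom_var q * b\<^sup>2 / 2)))
      \<le> (2 * C0 * M + 2) * \<bar>b\<bar> ^ 3" if q: "0 \<le> q" "q \<le> q1" for q b
  proof -
    define p where "p = 1 - q"
    define \<mu> where "\<mu> = geom_mean q"
    define s where "s = geom_var q"
    have p: "0 < p" "p \<le> 1" using q q1 by (auto simp: p_def)
    have qp: "q = 1 - p" by (simp add: p_def)
    have "(1 - q1)\<^sup>2 \<le> p\<^sup>2" using q q1 by (intro power_mono) (auto simp: p_def)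
    then have "1 / p\<^sup>2 \<le> M" unfolding M_def using q1 p by (intro divide_left_mono) auto
    moreover have "p\<^sup>2 \<le> p" using p by (simp add: power2_eq_square mult_le_one)
    then have "1 / p \<le> 1 / p\<^sup>2" using p by (intro divide_left_mono) auto
    ultimately have pM: "1 / p \<le> M" by linarith
    have "q / p\<^sup>2 \<le> 1 / p\<^sup>2" "q / p \<le> 1 / p" using q q1 p by (auto simp: divide_right_mono)
    then have b1: "\<bar>\<mu>\<bar> \<le> M" "\<bar>1 + \<mu>\<bar> \<le> M" "\<bar>s\<bar> \<le> M"
      using p q q1 pM \<open>1 / p\<^sup>2 \<le> M\<close>
      by (auto simp: \<mu>_def s_def geom_mean_def geom_var_def p_def[symmetric] abs_le_iff field_simps qp)
    let ?E = "\<lambda>a. exp (\<i> * of_real a * of_real b - of_real s * (of_real b)\<^sup>2 / 2)"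
    have eE: "?E a = cis (a * b) * of_real (exp (- s * b\<^sup>2 / 2))" for a
      unfolding cis_conv_exp exp_of_real[symmetric] exp_add[symmetric] by (simp add: mult.assoc)
    show ?thesis
    proof (cases "\<bar>b\<bar> \<le> 1")
      case True
      let ?T = "\<lambda>a. 1 + \<i> * of_real a * of_real b - ((of_real a)\<^sup>2 + of_real s) * (of_real b)\<^sup>2 / 2"
      have T: "cmod (?E a - ?T a) \<le> C0 * \<bar>b\<bar> ^ 3" if "\<bar>a\<bar> \<le> M" for a
        using norm_exp_quadratic_Taylor[OF that b1(3) True] by (simp add: C0_def)
      \<comment> \<open>mean and variance are chosen so that the terms of order 1 and 2 cancel\<close>
      have m: "\<mu> - q * (1 + \<mu>) = 0" "\<mu>\<^sup>2 + s - q * ((1 + \<mu>)\<^sup>2 + s) = 0"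
        using p by (simp_all add: \<mu>_def s_def geom_mean_def geom_var_def qp field_simps power2_eq_square)
      have cancel: "of_real \<mu> - of_real q * (1 + of_real \<mu>) = (0 :: complex)"
        "(of_real \<mu>)\<^sup>2 + of_real s - of_real q * ((1 + of_real \<mu>)\<^sup>2 + of_real s) = (0 :: complex)"
        using m[THEN arg_cong, of complex_of_real]
        by (simp_all only: of_real_add of_real_mult of_real_diff of_real_power of_real_1 of_real_0)
      have TT: "?T \<mu> - of_real q * ?T (1 + \<mu>) = of_real p"
      proof -
        have "?T \<mu> - of_real q * ?T (1 + \<mu>) = 1 - of_real q + \<i> * of_real b * (of_real \<mu> - of_real q * (1 + of_real \<mu>))
          - (of_real b)\<^sup>2 / 2 * ((of_real \<mu>)\<^sup>2 + of_real s - of_real q * ((1 + of_real \<mu>)\<^sup>2 + of_real s))"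
          by (simp add: field_simps)
        then show ?thesis unfolding cancel by (simp add: p_def)
      qed
      have tri: "cmod (of_real q * X - Y) \<le> q * K + K" if "cmod X \<le> K" "cmod Y \<le> K" for X Y K
        using norm_triangle_ineq4[of "of_real q * X" Y] that(2) mult_left_mono[OF that(1) q(1)] q
        by (simp add: norm_mult)
      have num: "cmod (of_real p - (1 - of_real q * cis b) * ?E \<mu>) \<le> 2 * C0 * \<bar>b\<bar> ^ 3"
      proof -
        have "cis b * ?E \<mu> = ?E (1 + \<mu>)"
          unfolding eE by (simp add: cis_mult[symmetric] distrib_right)
        then have "of_real p - (1 - of_real q * cis b) * ?E \<mu>
          = of_real q * (?E (1 + \<mu>) - ?T (1 + \<mu>)) - (?E \<mu> - ?T \<mu>)"
          unfolding TT[symmetric] by (simp add: algebra_simps)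
        also have "cmod \<dots> \<le> q * (C0 * \<bar>b\<bar> ^ 3) + C0 * \<bar>b\<bar> ^ 3"
          by (rule tri[OF T[OF b1(2)] T[OF b1(1)]])
        also have "\<dots> \<le> 1 * (C0 * \<bar>b\<bar> ^ 3) + C0 * \<bar>b\<bar> ^ 3"
          using q q1 C0 by (intro add_right_mono mult_right_mono) auto
        finally show ?thesis by simp
      qed
      have nz: "1 - of_real q * cis b \<noteq> 0" using q q1 by (intro one_minus_mult_cis_nz) auto
      have den: "p \<le> cmod (1 - of_real q * cis b)"
        using norm_triangle_ineq2[of 1 "of_real q * cis b"] q by (simp add: norm_mult p_def)
      have "geometric_char q b * cis (- \<mu> * b) - of_real (exp (- s * b\<^sup>2 / 2))
        = (geometric_char q b - ?E \<mu>) * cis (- \<mu> * b)"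
      proof -
        have "(G - c * e) * d = G * d - (c * d) * e" for G c d e :: complex
          by (simp add: algebra_simps)
        then show ?thesis unfolding eE by (simp add: cis_mult)
      qed
      also have "cmod \<dots> = cmod (geometric_char q b - ?E \<mu>)" by (simp add: norm_mult)
      also have "geometric_char q b - ?E \<mu> = (of_real p - (1 - of_real q * cis b) * ?E \<mu>) / (1 - of_real q * cis b)"
        using nz by (simp add: geometric_char_def p_def[symmetric] field_simps)
      also have "cmod \<dots> \<le> 2 * C0 * \<bar>b\<bar> ^ 3 / p"
        unfolding norm_divide using num den p C0 by (intro frac_le) auto
      also have "\<dots> = 2 * C0 * \<bar>b\<bar> ^ 3 * (1 / p)" by simp
      also have "\<dots> \<le> 2 * C0 * \<bar>b\<bar> ^ 3 * M" using pM C0 by (intro mult_left_mono) auto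
      also have "\<dots> \<le> (2 * C0 * M + 2) * \<bar>b\<bar> ^ 3" by (simp add: algebra_simps)
      finally show ?thesis by (simp add: \<mu>_def s_def)
    next
      case False
      \<comment> \<open>For |b| > 1 nothing has to be approximated: both terms have modulus at most
        1, and |b|^3 >= 1.\<close>
      have gc: "cmod (geometric_char q b) \<le> 1"
      proof -
        have "p \<le> cmod (1 - of_real q * cis b)"
          using norm_triangle_ineq2[of 1 "of_real q * cis b"] q by (simp add: norm_mult p_def)
        moreover have "cmod (1 - of_real q) = p" using p norm_of_real[of p] by (simp add: p_def)
        ultimately show ?thesis using p by (simp add: geometric_char_def norm_divide divide_le_eq)
      qed
      have "exp (- s * b\<^sup>2 / 2) \<le> 1" using q q1 by (simp add: s_def geom_var_def)
      then have "cmod (geometric_char q b * cis (- \<mu> * b) - of_real (exp (- s * b\<^sup>2 / 2))) \<le> 1 + 1"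
        using gc by (intro order.trans[OF norm_triangle_ineq4] add_mono) (auto simp: norm_mult)
      also have "\<dots> \<le> 2 * \<bar>b\<bar> ^ 3" using False by (simp add: one_le_power)
      also have "\<dots> \<le> (2 * C0 * M + 2) * \<bar>b\<bar> ^ 3"
        using C0 M0 by (intro mult_right_mono) auto
      finally show ?thesis by (simp add: \<mu>_def s_def)
    qed
  qed
  moreover have "2 * C0 * M + 2 > 0" using C0 M0 by (simp add: add_pos_pos)
  ultimately show ?thesis by blast
qed

section \<open>Products of characteristic functions\<close>

text \<open>Dividing each factor by its majorant \<open>g i\<close> brings all moduli below 1, so
  that \<open>norm_prod_diff\<close> applies and the decaying product of the \<open>g i\<close>
  survives in front. The factor 1 / \<open>\<delta>\<close> pays for the one factor that is replaced
  by a difference.\<close>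

lemma norm_prod_diff_weighted:
  fixes z w :: "'i \<Rightarrow> complex" and g :: "'i \<Rightarrow> real"
  assumes g: "\<And>i. i \<in> I \<Longrightarrow> \<delta> \<le> g i" "0 < \<delta>"
    and z: "\<And>i. i \<in> I \<Longrightarrow> cmod (z i) \<le> g i" and w: "\<And>i. i \<in> I \<Longrightarrow> cmod (w i) \<le> g i"
  shows "cmod ((\<Prod>i\<in>I. z i) - (\<Prod>i\<in>I. w i)) \<le> (\<Prod>i\<in>I. g i) * (\<Sum>i\<in>I. cmod (z i - w i)) / \<delta>"
proof -
  have g0: "g i > 0" if "i \<in> I" for i using g(1)[OF that] g(2) by linarith
  have eq: "(\<Prod>i\<in>I. u i) = of_real (\<Prod>i\<in>I. g i) * (\<Prod>i\<in>I. u i / of_real (g i))"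
    for u :: "'i \<Rightarrow> complex"
    unfolding of_real_prod prod.distrib[symmetric] by (intro prod.cong refl) (auto dest!: g0)
  have "cmod ((\<Prod>i\<in>I. z i) - (\<Prod>i\<in>I. w i))
    = (\<Prod>i\<in>I. g i) * cmod ((\<Prod>i\<in>I. z i / of_real (g i)) - (\<Prod>i\<in>I. w i / of_real (g i)))"
    unfolding eq[of z] eq[of w] right_diff_distrib[symmetric] norm_mult norm_of_real
    using g0 by (subst abs_of_nonneg) (auto intro!: prod_nonneg simp: less_imp_le)
  also have "\<dots> \<le> (\<Prod>i\<in>I. g i) * (\<Sum>i\<in>I. cmod (z i / of_real (g i) - w i / of_real (g i)))"
    using z w g0 by (intro mult_left_mono norm_prod_diff prod_nonneg) (auto simp: norm_divide less_imp_le)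
  also have "\<dots> \<le> (\<Prod>i\<in>I. g i) * (\<Sum>i\<in>I. cmod (z i - w i) / \<delta>)"
  proof (intro mult_left_mono sum_mono prod_nonneg)
    fix i assume i: "i \<in> I"
    have "cmod (z i / of_real (g i) - w i / of_real (g i)) = cmod (z i - w i) / g i"
      using g0[OF i] by (simp add: diff_divide_distrib[symmetric] norm_divide)
    also have "\<dots> \<le> cmod (z i - w i) / \<delta>" using g i g0[OF i] by (intro divide_left_mono) auto
    finally show "cmod (z i / of_real (g i) - w i / of_real (g i)) \<le> cmod (z i - w i) / \<delta>" .
  qed (use g0 in \<open>auto simp: less_imp_le\<close>)
  also have "\<dots> = (\<Prod>i\<in>I. g i) * (\<Sum>i\<in>I. cmod (z i - w i)) / \<delta>"
    by (simp only: sum_divide_distrib[symmetric] times_divide_eq_right)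
  finally show ?thesis .
qed

text \<open>Common majorant of both products, in the shape of \<open>sum_sin_squared_ge\<close>. The
  minimum with 1 is unavoidable there: a sum of m + 1 squared sines cannot exceed m + 1, however
  large m |t| is.\<close>

definition decay :: "real \<Rightarrow> nat \<Rightarrow> real \<Rightarrow> real \<Rightarrow> real" where
  "decay \<kappa> m t a = exp (- \<kappa> * m * (a\<^sup>2 + min 1 ((real m)\<^sup>2 * t\<^sup>2)))"

lemma exp_sum_sin_squared_le_decay:
  assumes "2 \<le> m" "\<bar>a\<bar> \<le> pi" "\<bar>t\<bar> \<le> pi" "0 \<le> \<kappa>"
  shows "(\<Prod>j<Suc m. exp (- \<kappa> * (sin ((a + real j * t) / 2))\<^sup>2)) \<le> decay (\<kappa> / 2304) m t a"
proof -
  have "\<kappa> * (m * (a\<^sup>2 + min 1 ((real m)\<^sup>2 * t\<^sup>2)) / 2304) \<le> \<kappa> * (\<Sum>j<Suc m. (sin ((a + real j * t) / 2))\<^sup>2)"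
    by (intro mult_left_mono sum_sin_squared_ge assms)
  then show ?thesis
    unfolding decay_def exp_sum[OF finite_lessThan, symmetric] sum_distrib_left[symmetric] by simp
qed

lemma abs_arith_le:
  fixes a t :: real
  assumes "j < Suc m"
  shows "\<bar>a + j * t\<bar> \<le> \<bar>a\<bar> + m * \<bar>t\<bar>"
proof -
  have "\<bar>a + j * t\<bar> \<le> \<bar>a\<bar> + j * \<bar>t\<bar>" using abs_triangle_ineq[of a "j * t"] by (simp add: abs_mult)
  also have "\<dots> \<le> \<bar>a\<bar> + m * \<bar>t\<bar>" using assms by (intro add_left_mono mult_right_mono) auto
  finally show ?thesis .
qed

lemma norm_cis_diff_one_le: "cmod (cis x - 1) \<le> \<bar>x\<bar>"
proof -
  have "cmod (cis x - 1) = 2 * \<bar>sin (x / 2)\<bar>"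
    using dist_exp_i_1[of x] by (simp add: cis_conv_exp mult.commute)
  also have "\<dots> \<le> 2 * \<bar>x / 2\<bar>" using abs_sin_x_le_abs_x[of "x / 2"] by simp
  finally show ?thesis by simp
qed

lemma prod_cis: "(\<Prod>j\<in>A. cis (f j)) = cis (\<Sum>j\<in>A. f j)"
  by (induction A rule: infinite_finite_induct) (simp_all add: cis_mult)

lemma norm_mult_unit_diff_le:
  assumes "cmod u = 1" "cmod (z - w) \<le> e" "cmod (u - 1) * cmod w \<le> e'"
  shows "cmod (z * u - w) \<le> e + e'"
proof -
  have "z * u - w = u * (z - w) + (u - 1) * w" by (simp add: algebra_simps)
  also have "cmod \<dots> \<le> cmod (u * (z - w)) + cmod ((u - 1) * w)" by (rule norm_triangle_ineq)
  finally show ?thesis using assms by (simp add: norm_mult)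
qed

text \<open>Fixes the range of the parameters strictly inside (0, 1), so that the estimates below
  are uniform over all sequences \<open>q\<close> in this range.\<close>

locale geometric_weights =
  fixes q0 q1 :: real
  assumes q0: "0 < q0" and q01: "q0 \<le> q1" and q1: "q1 < 1"
begin

definition "\<kappa> = 2 * q0 / (1 + 4 * q0) / 2304"

lemma \<kappa>_pos: "0 < \<kappa>"
  using q0 by (simp add: \<kappa>_def)

lemma norm_char_prod_le:
  assumes "\<And>j. q0 \<le> q j" "\<And>j. q j \<le> q1" "2 \<le> m" "\<bar>a\<bar> \<le> pi" "\<bar>t\<bar> \<le> pi"
  shows "cmod (\<Prod>j<Suc m. geometric_char (q j) (a + real j * t)) \<le> decay \<kappa> m t a"
proof -
  have "cmod (\<Prod>j<Suc m. geometric_char (q j) (a + real j * t))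
    \<le> (\<Prod>j<Suc m. exp (- (2 * q0 / (1 + 4 * q0)) * (sin ((a + real j * t) / 2))\<^sup>2))"
    unfolding prod_norm[symmetric]
    using assms q0 q1 by (intro prod_mono conjI norm_geometric_char_le) (auto intro: le_less_trans)
  also have "\<dots> \<le> decay \<kappa> m t a"
    unfolding \<kappa>_def using q0 assms by (intro exp_sum_sin_squared_le_decay) auto
  finally show ?thesis .
qed

text \<open>The product for centred normal variables with the same variances. It stays a product, to
  be compared factor by factor; what matters later is that it is real and nonnegative.\<close>

definition gauss :: "(nat \<Rightarrow> real) \<Rightarrow> nat \<Rightarrow> real \<Rightarrow> real \<Rightarrow> real" where
  "gauss q m t a = (\<Prod>j<Suc m. exp (- geom_var (q j) * (a + real j * t)\<^sup>2 / 2))"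

lemma gauss_factor_le:
  assumes "q0 \<le> q" "q \<le> q1"
  shows "exp (- geom_var q * b\<^sup>2 / 2) \<le> exp (- (2 * q0 / (1 + 4 * q0)) * (sin (b / 2))\<^sup>2)"
proof -
  have "2 * q0 / (1 + 4 * q0) \<le> 2 * q0" using q0 by (simp add: divide_le_eq)
  moreover have "(sin (b / 2))\<^sup>2 \<le> (b / 2)\<^sup>2"
    unfolding power2_abs[symmetric, of "sin _"] power2_abs[symmetric, of "b / 2"]
    by (intro power_mono abs_sin_x_le_abs_x) auto
  ultimately have "2 * q0 / (1 + 4 * q0) * (sin (b / 2))\<^sup>2 \<le> (2 * q0) * (b / 2)\<^sup>2"
    using q0 by (intro mult_mono) auto
  also have "\<dots> = q0 * b\<^sup>2 / 2" by (simp add: power_divide)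
  also have "\<dots> \<le> geom_var q * b\<^sup>2 / 2"
  proof -
    have "q0 \<le> q / 1" using assms by simp
    also have "\<dots> \<le> geom_var q"
      unfolding geom_var_def using assms q0 q1
      by (intro divide_left_mono) (auto simp: power_le_one zero_less_power)
    finally show ?thesis by (intro divide_right_mono mult_right_mono) auto
  qed
  finally show ?thesis by simp
qed

lemma gauss_le:
  assumes "\<And>j. q0 \<le> q j" "\<And>j. q j \<le> q1" "2 \<le> m" "\<bar>a\<bar> \<le> pi" "\<bar>t\<bar> \<le> pi"
  shows "gauss q m t a \<le> decay \<kappa> m t a"
proof -
  have "gauss q m t a \<le> (\<Prod>j<Suc m. exp (- (2 * q0 / (1 + 4 * q0)) * (sin ((a + real j * t) / 2))\<^sup>2))"
    unfolding gauss_def using assms by (intro prod_mono conjI gauss_factor_le) auto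
  also have "\<dots> \<le> decay \<kappa> m t a"
    unfolding \<kappa>_def using q0 assms by (intro exp_sum_sin_squared_le_decay) auto
  finally show ?thesis .
qed

definition var_max :: real where "var_max = 1 / (1 - q1)\<^sup>2"

lemma gauss_ge:
  assumes "\<And>j. q0 \<le> q j" "\<And>j. q j \<le> q1"
  shows "exp (- var_max * Suc m * (\<bar>a\<bar> + m * \<bar>t\<bar>)\<^sup>2) \<le> gauss q m t a"
proof -
  have "(\<Prod>j<Suc m. exp (- var_max * (\<bar>a\<bar> + m * \<bar>t\<bar>)\<^sup>2)) \<le> gauss q m t a"
    unfolding gauss_def
  proof (intro prod_mono conjI)
    fix j assume j: "j \<in> {..<Suc m}"
    have "geom_var (q j) \<le> var_max"
      unfolding geom_var_def var_max_def using assms[of j] q0 q1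
      by (intro frac_le power_mono) auto
    moreover have "(a + real j * t)\<^sup>2 \<le> (\<bar>a\<bar> + m * \<bar>t\<bar>)\<^sup>2"
      unfolding power2_abs[symmetric, of "a + _"] using j by (intro power_mono abs_arith_le) auto
    ultimately have "geom_var (q j) * (a + real j * t)\<^sup>2 \<le> var_max * (\<bar>a\<bar> + m * \<bar>t\<bar>)\<^sup>2"
      by (intro mult_mono) (auto simp: var_max_def)
    moreover have "0 \<le> geom_var (q j) * (a + real j * t)\<^sup>2"
      using assms[of j] q0 by (auto simp: geom_var_def)
    ultimately show "exp (- var_max * (\<bar>a\<bar> + m * \<bar>t\<bar>)\<^sup>2) \<le> exp (- geom_var (q j) * (a + real j * t)\<^sup>2 / 2)"
      by simp
  qed auto
  then show ?thesis by (simp add: exp_of_nat_mult[symmetric] algebra_simps flip: exp_add)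
qed

definition integrand :: "(nat \<Rightarrow> real) \<Rightarrow> nat \<Rightarrow> real \<Rightarrow> real \<Rightarrow> real \<Rightarrow> real \<Rightarrow> complex" where
  "integrand q m l n t a = (\<Prod>j<Suc m. geometric_char (q j) (a + real j * t)) * cis (- (l * a + n * t))"

lemma norm_integrand_le:
  assumes "\<And>j. q0 \<le> q j" "\<And>j. q j \<le> q1" "2 \<le> m" "\<bar>a\<bar> \<le> pi" "\<bar>t\<bar> \<le> pi"
  shows "cmod (integrand q m l n t a) \<le> decay \<kappa> m t a"
  using norm_char_prod_le[OF assms] by (simp add: integrand_def norm_mult)

text \<open>There are two sources of error. The m + 1 <= 2 m factors each contribute a cubic error
  in |a + j t| <= |a| + m |t|. Centring them leaves the phase \<open>x\<close>, because the means
  agree with \<open>l\<close> and \<open>n\<close> only up to \<open>\<Delta>\<close> and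
  \<open>\<Delta> * m\<close>.\<close>

lemma integrand_approx:
  "\<exists>C>0. \<forall>\<Delta> q m l n t a. (\<forall>j. q0 \<le> q j \<and> q j \<le> q1) \<longrightarrow> 2 \<le> m \<longrightarrow> \<bar>a\<bar> \<le> pi \<longrightarrow> \<bar>t\<bar> \<le> pi \<longrightarrow>
     \<bar>(\<Sum>j<Suc m. geom_mean (q j)) - l\<bar> \<le> \<Delta> \<longrightarrow>
     \<bar>(\<Sum>j<Suc m. j * geom_mean (q j)) - n\<bar> \<le> \<Delta> * m \<longrightarrow>
     cmod (integrand q m l n t a - of_real (gauss q m t a))
       \<le> (C * m * (\<bar>a\<bar> + m * \<bar>t\<bar>) ^ 3 + \<Delta> * (\<bar>a\<bar> + m * \<bar>t\<bar>)) * decay \<kappa> m t a"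
proof -
  obtain C where C: "0 < C" and approx: "\<And>q b. 0 \<le> q \<Longrightarrow> q \<le> q1 \<Longrightarrow>
    cmod (geometric_char q b * cis (- geom_mean q * b) - of_real (exp (- geom_var q * b\<^sup>2 / 2))) \<le> C * \<bar>b\<bar> ^ 3"
    using geometric_char_approx[OF q1] by blast
  let ?K = "2 * q0 / (1 + 4 * q0)"
  have K: "0 < ?K" using q0 by simp
  have "cmod (integrand q m l n t a - of_real (gauss q m t a))
       \<le> (2 * C * exp ?K * m * (\<bar>a\<bar> + m * \<bar>t\<bar>) ^ 3 + \<Delta> * (\<bar>a\<bar> + m * \<bar>t\<bar>)) * decay \<kappa> m t a"
    if q: "\<And>j. q0 \<le> q j" "\<And>j. q j \<le> q1" and m: "2 \<le> m" and at: "\<bar>a\<bar> \<le> pi" "\<bar>t\<bar> \<le> pi"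
      and \<Delta>: "\<bar>(\<Sum>j<Suc m. geom_mean (q j)) - l\<bar> \<le> \<Delta>" "\<bar>(\<Sum>j<Suc m. j * geom_mean (q j)) - n\<bar> \<le> \<Delta> * m"
    for \<Delta> q m l n t a
  proof -
    define s where "s = \<bar>a\<bar> + m * \<bar>t\<bar>"
    define x where "x = a * ((\<Sum>j<Suc m. geom_mean (q j)) - l) + t * ((\<Sum>j<Suc m. j * geom_mean (q j)) - n)"
    let ?z = "\<lambda>j. geometric_char (q j) (a + real j * t) * cis (- geom_mean (q j) * (a + real j * t))"
    let ?w = "\<lambda>j. complex_of_real (exp (- geom_var (q j) * (a + real j * t)\<^sup>2 / 2))"
    let ?g = "\<lambda>j. exp (- ?K * (sin ((a + real j * t) / 2))\<^sup>2)"
    have s0: "0 \<le> s" by (simp add: s_def)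
    have "cmod ((\<Prod>j<Suc m. ?z j) - (\<Prod>j<Suc m. ?w j))
       \<le> (\<Prod>j<Suc m. ?g j) * (\<Sum>j<Suc m. cmod (?z j - ?w j)) / exp (- ?K)"
    proof (rule norm_prod_diff_weighted)
      fix j
      show "cmod (?z j) \<le> ?g j"
        using norm_geometric_char_le[OF q0 q(1) le_less_trans[OF q(2) q1]] by (simp add: norm_mult)
      show "cmod (?w j) \<le> ?g j" using gauss_factor_le[OF q(1) q(2)] by simp
      have "?K * (sin ((a + real j * t) / 2))\<^sup>2 \<le> ?K * 1"
        using K by (intro mult_left_mono) (auto simp: abs_square_le_1)
      then show "exp (- ?K) \<le> ?g j" by simp
    qed simp
    also have "\<dots> = exp ?K * ((\<Prod>j<Suc m. ?g j) * (\<Sum>j<Suc m. cmod (?z j - ?w j)))"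
      by (simp add: exp_minus field_simps)
    also have "\<dots> \<le> exp ?K * (decay \<kappa> m t a * (\<Sum>j<Suc m. C * s ^ 3))"
    proof (intro mult_left_mono mult_mono sum_mono)
      show "(\<Prod>j<Suc m. ?g j) \<le> decay \<kappa> m t a"
        unfolding \<kappa>_def using K m at by (intro exp_sum_sin_squared_le_decay) auto
      fix j assume j: "j \<in> {..<Suc m}"
      have "cmod (?z j - ?w j) \<le> C * \<bar>a + real j * t\<bar> ^ 3"
        using q[of j] q0 by (intro approx) auto
      also have "\<dots> \<le> C * s ^ 3"
        unfolding s_def using C j by (intro mult_left_mono power_mono abs_arith_le) auto
      finally show "cmod (?z j - ?w j) \<le> C * s ^ 3" .
    qed (auto simp: decay_def simp del: sum.lessThan_Suc intro!: sum_nonneg)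
    also have "\<dots> = real (Suc m) * (exp ?K * decay \<kappa> m t a * C * s ^ 3)"
      by simp
    also have "\<dots> \<le> (2 * real m) * (exp ?K * decay \<kappa> m t a * C * s ^ 3)"
      using m C s0 by (intro mult_right_mono) (auto simp: decay_def)
    finally have prod_le: "cmod ((\<Prod>j<Suc m. ?z j) - (\<Prod>j<Suc m. ?w j)) \<le> 2 * C * exp ?K * m * s ^ 3 * decay \<kappa> m t a"
      by (simp add: mult_ac)
    have w: "(\<Prod>j<Suc m. ?w j) = of_real (gauss q m t a)" by (simp add: gauss_def)
    have "(\<Prod>j<Suc m. cis (- geom_mean (q j) * (a + real j * t))) = cis (\<Sum>j<Suc m. - geom_mean (q j) * (a + real j * t))"
      by (rule prod_cis)
    also have "(\<Sum>j<Suc m. - geom_mean (q j) * (a + real j * t)) = - (l * a + n * t) - x"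
      by (simp add: x_def sum_distrib_left sum.distrib sum_negf sum_subtractf algebra_simps)
    finally have z: "integrand q m l n t a = (\<Prod>j<Suc m. ?z j) * cis x"
      unfolding integrand_def prod.distrib by (simp add: mult.assoc cis_mult)
    have "\<bar>x\<bar> \<le> \<bar>a\<bar> * \<Delta> + \<bar>t\<bar> * (\<Delta> * m)"
      unfolding x_def by (rule order.trans[OF abs_triangle_ineq])
        (unfold abs_mult, intro add_mono mult_left_mono \<Delta> abs_ge_zero)
    then have x: "\<bar>x\<bar> \<le> \<Delta> * s" by (simp add: s_def algebra_simps)
    have "0 \<le> gauss q m t a" by (simp add: gauss_def prod_nonneg)
    then have "cmod (cis x - 1) * cmod (of_real (gauss q m t a)) \<le> (\<Delta> * s) * decay \<kappa> m t a"
      unfolding norm_of_real using gauss_le[OF q m at] norm_cis_diff_one_le[of x] x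
      by (intro mult_mono) auto
    with prod_le have "cmod (integrand q m l n t a - of_real (gauss q m t a))
        \<le> 2 * C * exp ?K * m * s ^ 3 * decay \<kappa> m t a + (\<Delta> * s) * decay \<kappa> m t a"
      unfolding z w by (rule norm_mult_unit_diff_le[OF norm_cis])
    then show ?thesis unfolding s_def by (simp only: distrib_right)
  qed
  moreover have "2 * C * exp ?K > 0" using C by simp
  ultimately show ?thesis by blast
qed

end

section \<open>The local limit estimate\<close>

lemma power_times_exp_bounded:
  fixes \<kappa> :: real
  assumes "0 < \<kappa>"
  shows "\<exists>C>0. \<forall>x\<ge>0. (1 + x) ^ k * exp (- \<kappa> * x) \<le> C"
proof (cases "k = 0")
  case True
  then show ?thesis using assms by (intro exI[of _ 1]) auto
next
  case False
  define K where "K = max 1 (k / \<kappa>)"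
  have K: "1 \<le> K" "k / \<kappa> \<le> K" by (auto simp: K_def)
  have "(1 + x) ^ k * exp (- \<kappa> * x) \<le> K ^ k" if x: "0 \<le> x" for x
  proof -
    have "x = k / \<kappa> * (\<kappa> * x / k)" using False assms by simp
    also have "\<dots> \<le> K * (\<kappa> * x / k)" using K x assms by (intro mult_right_mono) auto
    finally have "1 + x \<le> K * (1 + \<kappa> * x / k)" using K by (simp add: distrib_left)
    also have "\<dots> \<le> K * exp (\<kappa> * x / k)" using K by (intro mult_left_mono exp_ge_add_one_self) auto
    finally have "(1 + x) ^ k \<le> (K * exp (\<kappa> * x / k)) ^ k" using x by (intro power_mono) auto
    also have "\<dots> = K ^ k * exp (\<kappa> * x)"
      using False by (simp add: power_mult_distrib exp_of_nat_mult[symmetric])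
    finally have "(1 + x) ^ k * exp (- \<kappa> * x) \<le> K ^ k * exp (\<kappa> * x) * exp (- \<kappa> * x)"
      by (intro mult_right_mono) auto
    then show ?thesis by (simp add: mult.assoc flip: exp_add)
  qed
  then show ?thesis using K by (intro exI[of _ "K ^ k"]) auto
qed

text \<open>A majorant at the natural scales t ~ m^(-3/2) and a ~ m^(-1/2). Its product form splits
  the torus integral into two arctangents, with a result of order m^(-2).\<close>

definition cauchy_weight :: "nat \<Rightarrow> real \<Rightarrow> real \<Rightarrow> real" where
  "cauchy_weight m t a = 1 / (1 + real m ^ 3 * t\<^sup>2) * (1 / (1 + m * a\<^sup>2))"

lemma one_plus_nonneg_nz: "0 \<le> x \<Longrightarrow> 1 + x \<noteq> (0::real)"
  by linarith

lemma continuous_on_cauchy_weight [continuous_intros]: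
  "continuous_on S f \<Longrightarrow> continuous_on S g \<Longrightarrow> continuous_on S (\<lambda>x. cauchy_weight m (f x) (g x))"
  unfolding cauchy_weight_def
  by (intro continuous_intros ballI one_plus_nonneg_nz) auto

lemma integral_inverse_quadratic_le:
  fixes c :: real
  assumes c: "0 < c"
  shows "integral {-pi..pi} (\<lambda>u. 1 / (1 + c * u\<^sup>2)) \<le> pi / sqrt c"
proof -
  have sc: "0 < sqrt c" "sqrt c * sqrt c = c" using c by auto
  have "((\<lambda>u. 1 / (1 + c * u\<^sup>2)) has_integral arctan (sqrt c * pi) / sqrt c - arctan (sqrt c * (- pi)) / sqrt c) {-pi..pi}"
  proof (rule fundamental_theorem_of_calculus)
    fix u :: real
    have "((\<lambda>u. arctan (sqrt c * u) / sqrt c) has_real_derivative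
       (1 / (1 + (sqrt c * u)\<^sup>2) * sqrt c) / sqrt c) (at u within {-pi..pi})"
      by (rule derivative_eq_intros refl | use sc in \<open>simp add: inverse_eq_divide\<close>)+
    then show "((\<lambda>u. arctan (sqrt c * u) / sqrt c) has_vector_derivative 1 / (1 + c * u\<^sup>2)) (at u within {-pi..pi})"
      using sc c by (simp add: has_real_derivative_iff_has_vector_derivative power_mult_distrib)
  qed simp
  then have "integral {-pi..pi} (\<lambda>u. 1 / (1 + c * u\<^sup>2)) = 2 * arctan (sqrt c * pi) / sqrt c"
    by (simp add: integral_unique arctan_minus)
  also have "\<dots> \<le> pi / sqrt c"
    using arctan_ubound[of "sqrt c * pi"] c by (intro divide_right_mono) auto
  finally show ?thesis .
qed

abbreviation torus :: "(real \<times> real) set" where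
  "torus \<equiv> cbox (-pi, -pi) (pi, pi)"

lemma in_torusD: "(t, a) \<in> torus \<Longrightarrow> \<bar>t\<bar> \<le> pi \<and> \<bar>a\<bar> \<le> pi"
  by (auto simp: cbox_Pair_eq)

lemma integral_cauchy_weight_le:
  assumes m: "0 < m"
  shows "integral torus (\<lambda>(t, a). cauchy_weight m t a) \<le> pi\<^sup>2 / (real m)\<^sup>2"
proof -
  have "continuous_on torus (\<lambda>(t, a). cauchy_weight m t a)"
    unfolding case_prod_unfold by (intro continuous_intros)
  then have "integral torus (\<lambda>(t, a). cauchy_weight m t a)
      = integral {-pi..pi} (\<lambda>t. integral {-pi..pi} (cauchy_weight m t))"
    by (subst integral_prod_continuous) simp_all
  also have "\<dots> = integral {-pi..pi} (\<lambda>t. 1 / (1 + real m ^ 3 * t\<^sup>2) * integral {-pi..pi} (\<lambda>a. 1 / (1 + m * a\<^sup>2)))"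
    unfolding cauchy_weight_def integral_mult_right ..
  also have "\<dots> = integral {-pi..pi} (\<lambda>t. 1 / (1 + real m ^ 3 * t\<^sup>2)) * integral {-pi..pi} (\<lambda>a. 1 / (1 + m * a\<^sup>2))"
    by (rule integral_mult_left)
  also have "\<dots> \<le> pi / sqrt (real m ^ 3) * (pi / sqrt m)"
    using integral_inverse_quadratic_le[of "real m ^ 3"] integral_inverse_quadratic_le[of "real m"] m
    by (intro mult_mono integral_nonneg integrable_continuous_interval continuous_intros ballI one_plus_nonneg_nz)
       auto
  also have "\<dots> = pi\<^sup>2 / (sqrt (real m ^ 3) * sqrt m)" by (simp add: power2_eq_square)
  also have "sqrt (real m ^ 3) * sqrt m = sqrt (((real m)\<^sup>2)\<^sup>2)"
  proof -
    have "real m ^ 3 * m = ((real m)\<^sup>2)\<^sup>2" by (simp add: power3_eq_cube power2_eq_square)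
    then show ?thesis by (simp only: real_sqrt_mult[symmetric])
  qed
  also have "\<dots> = (real m)\<^sup>2" by (rule real_sqrt_unique) simp_all
  finally show ?thesis .
qed

text \<open>With s = |a| + m |t|, the factor (1 + m s^2)^2 makes room for every polynomial in the
  error terms. If m |t| <= 1, the exponent is the full quadratic x = m a^2 + m^3 t^2, and four
  powers of 1 + x are needed: two for the square, one for each factor of the weight. Otherwise the
  decay is at most exp(-\<open>\<kappa>\<close> m), which beats a polynomial in m of degree 6 + 3 +
  1 = 10; its constant contains 4913 = 17^3.\<close>

lemma decay_le_cauchy_weight:
  assumes \<kappa>: "0 < \<kappa>"
  shows "\<exists>C>0. \<forall>m t a. \<bar>t\<bar> \<le> pi \<longrightarrow> \<bar>a\<bar> \<le> pi \<longrightarrow>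
    (1 + m * (\<bar>a\<bar> + real m * \<bar>t\<bar>)\<^sup>2)\<^sup>2 * decay \<kappa> m t a \<le> C * cauchy_weight m t a"
proof -
  obtain C4 where C4: "0 < C4" "\<And>x. 0 \<le> x \<Longrightarrow> (1 + x) ^ 4 * exp (- \<kappa> * x) \<le> C4"
    using power_times_exp_bounded[OF \<kappa>, of 4] by blast
  obtain C10 where C10: "0 < C10" "\<And>x. 0 \<le> x \<Longrightarrow> (1 + x) ^ 10 * exp (- \<kappa> * x) \<le> C10"
    using power_times_exp_bounded[OF \<kappa>, of 10] by blast
  define C where "C = 4 * C4 + 4913 * 16 * C10"
  have main: "(1 + m * (\<bar>a\<bar> + real m * \<bar>t\<bar>)\<^sup>2)\<^sup>2 * decay \<kappa> m t a * ((1 + real m ^ 3 * t\<^sup>2) * (1 + m * a\<^sup>2)) \<le> C"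
    if ta: "\<bar>t\<bar> \<le> pi" "\<bar>a\<bar> \<le> pi" for m :: nat and t a :: real
  proof -
    define s where "s = \<bar>a\<bar> + real m * \<bar>t\<bar>"
    show ?thesis
    proof (cases "m * \<bar>t\<bar> \<le> 1")
      case True
      define x where "x = m * (a\<^sup>2 + (real m)\<^sup>2 * t\<^sup>2)"
      have x0: "0 \<le> x" by (simp add: x_def)
      have "(m * \<bar>t\<bar>)\<^sup>2 \<le> 1" using True by (simp add: abs_square_le_1)
      then have d: "decay \<kappa> m t a = exp (- \<kappa> * x)"
        by (simp add: decay_def x_def min_def power_mult_distrib)
      have "s\<^sup>2 \<le> 2 * (a\<^sup>2 + (real m)\<^sup>2 * t\<^sup>2)"
        using sum_squares_bound[of "\<bar>a\<bar>" "real m * \<bar>t\<bar>"]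
        by (simp add: s_def power2_sum power_mult_distrib ac_simps)
      then have "m * s\<^sup>2 \<le> m * (2 * (a\<^sup>2 + (real m)\<^sup>2 * t\<^sup>2))" by (intro mult_left_mono) auto
      then have "1 + m * s\<^sup>2 \<le> 2 * (1 + x)" by (simp add: x_def algebra_simps)
      then have "(1 + m * s\<^sup>2)\<^sup>2 \<le> (2 * (1 + x))\<^sup>2" by (intro power_mono) auto
      moreover have "x = m * a\<^sup>2 + real m ^ 3 * t\<^sup>2"
        by (simp add: x_def power3_eq_cube power2_eq_square algebra_simps)
      then have "1 + real m ^ 3 * t\<^sup>2 \<le> 1 + x" "1 + m * a\<^sup>2 \<le> 1 + x"
        by simp_all
      ultimately have "(1 + m * s\<^sup>2)\<^sup>2 * exp (- \<kappa> * x) * ((1 + real m ^ 3 * t\<^sup>2) * (1 + m * a\<^sup>2))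
          \<le> (2 * (1 + x))\<^sup>2 * exp (- \<kappa> * x) * ((1 + x) * (1 + x))"
        using x0 by (intro mult_mono) auto
      also have "\<dots> = 4 * ((1 + x) ^ 4 * exp (- \<kappa> * x))"
      proof -
        have "(2 * u)\<^sup>2 * e * (u * u) = 4 * (u ^ 4 * e)" for u e :: real
          by (simp add: power4_eq_xxxx power2_eq_square)
        then show ?thesis .
      qed
      also have "\<dots> \<le> 4 * C4" using C4(2)[OF x0] by simp
      also have "\<dots> \<le> C" using C10 by (simp add: C_def)
      finally show ?thesis by (simp add: d s_def)
    next
      case False
      define x where "x = real m"
      have x0: "0 \<le> x" by (simp add: x_def)
      have "1\<^sup>2 \<le> (m * \<bar>t\<bar>)\<^sup>2" using False by (intro power_mono) auto
      then have "1 \<le> (real m)\<^sup>2 * t\<^sup>2" by (simp add: power_mult_distrib)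
      then have d: "decay \<kappa> m t a \<le> exp (- \<kappa> * x)"
        using \<kappa> by (simp add: decay_def x_def min_def distrib_left)
      have "s \<le> 4 + x * 4"
        unfolding s_def x_def using ta pi_less_4 by (intro add_mono mult_left_mono) auto
      then have "s\<^sup>2 \<le> (4 * (1 + x))\<^sup>2" using x0 by (intro power_mono) (auto simp: s_def)
      then have "x * s\<^sup>2 \<le> (1 + x) * (4 * (1 + x))\<^sup>2" using x0 by (intro mult_mono) auto
      also have "\<dots> = 16 * (1 + x) ^ 3"
      proof -
        have "u * (4 * u)\<^sup>2 = 16 * u ^ 3" for u :: real
          by (simp add: power3_eq_cube power2_eq_square)
        then show ?thesis .
      qed
      finally have "1 + x * s\<^sup>2 \<le> 17 * (1 + x) ^ 3"
        using one_le_power[of "1 + x" 3] x0 by linarith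
      then have w: "(1 + x * s\<^sup>2)\<^sup>2 \<le> (17 * (1 + x) ^ 3)\<^sup>2" using x0 by (intro power_mono) auto
      have sq: "u\<^sup>2 \<le> 16" if "\<bar>u\<bar> \<le> pi" for u :: real
        using power_mono[of "\<bar>u\<bar>" 4 2] that pi_less_4 by simp
      have "x ^ 3 * t\<^sup>2 \<le> (1 + x) ^ 3 * 16" using sq[OF ta(1)] x0 by (intro mult_mono power_mono) auto
      then have b1: "1 + x ^ 3 * t\<^sup>2 \<le> 17 * (1 + x) ^ 3" using one_le_power[of "1 + x" 3] x0 by linarith
      have "x * a\<^sup>2 \<le> x * 16" using sq[OF ta(2)] x0 by (intro mult_left_mono) auto
      then have b2: "1 + x * a\<^sup>2 \<le> 16 * (1 + x)" by simp
      have "(1 + x * s\<^sup>2)\<^sup>2 * decay \<kappa> m t a * ((1 + x ^ 3 * t\<^sup>2) * (1 + x * a\<^sup>2))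
        \<le> (17 * (1 + x) ^ 3)\<^sup>2 * exp (- \<kappa> * x) * ((17 * (1 + x) ^ 3) * (16 * (1 + x)))"
        using w b1 b2 d x0 by (intro mult_mono) (auto simp: decay_def)
      also have "\<dots> = 4913 * 16 * ((1 + x) ^ 10 * exp (- \<kappa> * x))"
      proof -
        have "(17 * u ^ 3)\<^sup>2 * e * ((17 * u ^ 3) * (16 * u)) = 4913 * 16 * (u ^ 10 * e)" for u e :: real
          by (simp add: power_mult_distrib power_numeral_reduce)
        then show ?thesis .
      qed
      also have "\<dots> \<le> 4913 * 16 * C10" using C10(2)[OF x0] C10(1) by linarith
      also have "\<dots> \<le> C" using C4 by (simp add: C_def)
      finally show ?thesis by (simp add: x_def s_def)
    qed
  qed
  have "(1 + m * (\<bar>a\<bar> + real m * \<bar>t\<bar>)\<^sup>2)\<^sup>2 * decay \<kappa> m t a \<le> C * cauchy_weight m t a"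
    if ta: "\<bar>t\<bar> \<le> pi" "\<bar>a\<bar> \<le> pi" for m :: nat and t a :: real
  proof -
    have "0 < (1 + real m ^ 3 * t\<^sup>2) * (1 + m * a\<^sup>2)"
      by (intro mult_pos_pos add_pos_nonneg) auto
    then show ?thesis using main[OF ta, of m] by (simp add: cauchy_weight_def pos_le_divide_eq)
  qed
  moreover have "0 < C" using C4 C10 by (simp add: C_def)
  ultimately show ?thesis by blast
qed

lemma integrable_on_torus: "continuous_on torus f \<Longrightarrow> f integrable_on torus" for f :: "real \<times> real \<Rightarrow> real"
  by (rule integrable_continuous)

section \<open>The inversion integral and its increment\<close>

context geometric_weights
begin

lemma continuous_on_integrand [continuous_intros]:
  assumes "\<And>j. q0 \<le> q j" "\<And>j. q j \<le> q1" "continuous_on S f" "continuous_on S g"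
  shows "continuous_on S (\<lambda>x. integrand q m l n (f x) (g x))"
  unfolding integrand_def
  by (intro continuous_intros assms)
     (use assms(1,2) q0 q1 in \<open>auto intro: less_imp_le less_le_trans le_less_trans\<close>)

lemma continuous_on_gauss [continuous_intros]:
  assumes "continuous_on S f" "continuous_on S g"
  shows "continuous_on S (\<lambda>x. gauss q m (f x) (g x))"
  unfolding gauss_def by (intro continuous_intros assms) auto

text \<open>Replacing (t, a) by (-t, -a) conjugates the integrand, so the real part loses nothing.
  It makes the first-order contribution of the Gaussian to the increment vanish pointwise.\<close>

definition box_integral :: "(nat \<Rightarrow> real) \<Rightarrow> nat \<Rightarrow> real \<Rightarrow> real \<Rightarrow> real" where
  "box_integral q m l n = integral torus (\<lambda>(t, a). Re (integrand q m l n t a))"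

lemma abs_integral_torus_le:
  assumes "continuous_on torus (\<lambda>(t, a). f t a)"
    "\<And>t a. \<bar>t\<bar> \<le> pi \<Longrightarrow> \<bar>a\<bar> \<le> pi \<Longrightarrow> \<bar>f t a\<bar> \<le> K * cauchy_weight m t a"
    and "0 \<le> K" "0 < m"
  shows "\<bar>integral torus (\<lambda>(t, a). f t a)\<bar> \<le> K * (pi\<^sup>2 / (real m)\<^sup>2)"
proof -
  have c: "continuous_on torus (\<lambda>(t, a). cauchy_weight m t a)"
    unfolding case_prod_unfold by (intro continuous_intros)
  have "norm (integral torus (\<lambda>(t, a). f t a)) \<le> integral torus (\<lambda>p. K * (case p of (t, a) \<Rightarrow> cauchy_weight m t a))"
  proof (intro integral_norm_bound_integral integrable_on_torus continuous_intros c assms(1))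
    fix p assume "p \<in> torus"
    moreover obtain t a where p: "p = (t, a)" by (cases p)
    ultimately have "\<bar>f t a\<bar> \<le> K * cauchy_weight m t a"
      using in_torusD assms(2) by blast
    then show "norm (case p of (t, a) \<Rightarrow> f t a) \<le> K * (case p of (t, a) \<Rightarrow> cauchy_weight m t a)"
      by (simp add: p)
  qed
  also have "\<dots> = K * integral torus (\<lambda>(t, a). cauchy_weight m t a)"
    by (rule integral_mult_right)
  also have "\<dots> \<le> K * (pi\<^sup>2 / (real m)\<^sup>2)"
    using assms integral_cauchy_weight_le by (intro mult_left_mono) auto
  finally show ?thesis by simp
qed

text \<open>It suffices to integrate over |t| <= m^(-3/2), |a| <= m^(-1/2), a box of area 4 / m^2.
  There |a| + m |t| <= 2 m^(-1/2), and m + 1 <= 2 m makes the exponent at most 8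
  \<open>var_max\<close>.\<close>

lemma integral_gauss_ge:
  assumes q: "\<And>j. q0 \<le> q j" "\<And>j. q j \<le> q1" and m: "1 \<le> m"
  shows "4 * exp (- var_max * 8) / (real m)\<^sup>2 \<le> integral torus (\<lambda>(t, a). gauss q m t a)"
proof -
  define r where "r = 1 / sqrt m"
  define D where "D = cbox (- (r / m), - r) (r / m, r)"
  have r: "0 < r" "r \<le> 1" "r * r = 1 / m" using m by (auto simp: r_def)
  have rm: "0 < r / m" "r / m \<le> 1" using r m by (auto simp: divide_le_eq)
  have sub: "D \<subseteq> torus"
    unfolding D_def using r rm pi_gt3 by (intro subset_box_imp) (auto simp: Basis_prod_def)
  have c: "continuous_on S (\<lambda>(t, a). gauss q m t a)" for S
    unfolding case_prod_unfold by (intro continuous_intros)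
  have "4 * exp (- var_max * 8) / (real m)\<^sup>2 = exp (- var_max * 8) * (2 * (r / m)) * (2 * r)"
    using r by (simp add: power2_eq_square)
  also have "\<dots> = integral D (\<lambda>_. exp (- var_max * 8))"
    using r rm by (simp add: D_def content_Pair)
  also have "\<dots> \<le> integral D (\<lambda>(t, a). gauss q m t a)"
  proof (rule integral_le)
    show "(\<lambda>(t, a). gauss q m t a) integrable_on D"
      unfolding D_def by (intro integrable_continuous c)
    fix p assume "p \<in> D"
    then obtain t a where p: "p = (t, a)" "\<bar>t\<bar> \<le> r / m" "\<bar>a\<bar> \<le> r"
      by (cases p) (auto simp: D_def)
    have "m * \<bar>t\<bar> \<le> r" using p m by (simp add: field_simps)
    then have "(\<bar>a\<bar> + m * \<bar>t\<bar>)\<^sup>2 \<le> (2 * r)\<^sup>2" using p by (intro power_mono) auto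
    then have "Suc m * (\<bar>a\<bar> + m * \<bar>t\<bar>)\<^sup>2 \<le> (2 * m) * (2 * r)\<^sup>2" using m by (intro mult_mono) auto
    also have "\<dots> = 8" using r m by (simp add: power2_eq_square)
    finally have "var_max * (Suc m * (\<bar>a\<bar> + m * \<bar>t\<bar>)\<^sup>2) \<le> var_max * 8"
      by (intro mult_left_mono) (auto simp: var_max_def)
    then have "exp (- var_max * 8) \<le> exp (- var_max * Suc m * (\<bar>a\<bar> + m * \<bar>t\<bar>)\<^sup>2)"
      by (simp add: mult.assoc)
    also have "\<dots> \<le> gauss q m t a" by (rule gauss_ge[OF q])
    finally show "exp (- var_max * 8) \<le> (case p of (t, a) \<Rightarrow> gauss q m t a)" by (simp add: p)
  qed (simp add: D_def integrable_on_const)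
  also have "\<dots> \<le> integral torus (\<lambda>(t, a). gauss q m t a)"
    unfolding D_def
    by (intro integral_subset_le sub[unfolded D_def] integrable_continuous c)
       (auto simp: gauss_def prod_nonneg)
  finally show ?thesis .
qed

lemma box_integral_bounds:
  "\<exists>c>0. \<exists>C>0. \<exists>M. \<forall>q m l n. (\<forall>j. q0 \<le> q j \<and> q j \<le> q1) \<longrightarrow> M \<le> m \<longrightarrow>
     \<bar>(\<Sum>j<Suc m. geom_mean (q j)) - l\<bar> \<le> \<Delta> \<longrightarrow>
     \<bar>(\<Sum>j<Suc m. j * geom_mean (q j)) - n\<bar> \<le> \<Delta> * m \<longrightarrow>
     c / (real m)\<^sup>2 \<le> box_integral q m l n \<and>
     \<bar>box_integral q m l (n + 1) - box_integral q m l n\<bar> \<le> C / (real m) ^ 4"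
proof (cases "0 \<le> \<Delta>")
  case False
  then have "\<not> \<bar>x\<bar> \<le> \<Delta>" for x by linarith
  then show ?thesis by (intro exI[of _ "1::real"] conjI exI[of _ "0::nat"]) auto
next
  case \<Delta>0: True
  obtain C1 where C1: "0 < C1" and approx: "\<And>\<Delta> q m l n t a. (\<forall>j. q0 \<le> q j \<and> q j \<le> q1) \<Longrightarrow> 2 \<le> m \<Longrightarrow> \<bar>a\<bar> \<le> pi \<Longrightarrow> \<bar>t\<bar> \<le> pi \<Longrightarrow>
     \<bar>(\<Sum>j<Suc m. geom_mean (q j)) - l\<bar> \<le> \<Delta> \<Longrightarrow>
     \<bar>(\<Sum>j<Suc m. j * geom_mean (q j)) - n\<bar> \<le> \<Delta> * m \<Longrightarrow>
     cmod (integrand q m l n t a - of_real (gauss q m t a))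
       \<le> (C1 * m * (\<bar>a\<bar> + m * \<bar>t\<bar>) ^ 3 + \<Delta> * (\<bar>a\<bar> + m * \<bar>t\<bar>)) * decay \<kappa> m t a"
    using integrand_approx by blast
  obtain C2 where C2: "0 < C2" and weight: "\<And>m t a. \<bar>t\<bar> \<le> pi \<Longrightarrow> \<bar>a\<bar> \<le> pi \<Longrightarrow>
    (1 + m * (\<bar>a\<bar> + real m * \<bar>t\<bar>)\<^sup>2)\<^sup>2 * decay \<kappa> m t a \<le> C2 * cauchy_weight m t a"
    using decay_le_cauchy_weight[OF \<kappa>_pos] by blast
  define c where "c = exp (- var_max * 8)"
  define C3 where "C3 = (C1 + \<Delta>) * C2 * pi\<^sup>2"
  define C4 where "C4 = (1 + C1 + \<Delta>) * C2 * pi\<^sup>2"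
  \<comment> \<open>For m >= M the approximation error C3 m^(-1/2) m^(-2) is at most c m^(-2), while
    the Gaussian supplies 4 c m^(-2).\<close>
  define M where "M = max 2 (nat \<lceil>(C3 / c)\<^sup>2\<rceil>)"
  have c: "0 < c" by (simp add: c_def)
  have C34: "0 < C3" "0 < C4" using C1 C2 \<Delta>0 by (auto simp: C3_def C4_def add_pos_nonneg)
  have "c / (real m)\<^sup>2 \<le> box_integral q m l n \<and>
     \<bar>box_integral q m l (n + 1) - box_integral q m l n\<bar> \<le> C4 / (real m) ^ 4"
    if q: "\<forall>j. q0 \<le> q j \<and> q j \<le> q1" and M: "M \<le> m"
      and l: "\<bar>(\<Sum>j<Suc m. geom_mean (q j)) - l\<bar> \<le> \<Delta>"
      and n: "\<bar>(\<Sum>j<Suc m. j * geom_mean (q j)) - n\<bar> \<le> \<Delta> * m"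
    for q m l n
  proof
    have m: "2 \<le> m" and mC: "(C3 / c)\<^sup>2 \<le> m" using M unfolding M_def by linarith+
    have q': "\<And>j. q0 \<le> q j" "\<And>j. q j \<le> q1" using q by auto
    have cont: "continuous_on torus (\<lambda>(t, a). Re (integrand q m l n t a))" for n
      unfolding case_prod_unfold by (intro continuous_intros q')
    have contg: "continuous_on torus (\<lambda>(t, a). gauss q m t a)"
      unfolding case_prod_unfold by (intro continuous_intros)
    have wbound: "(1 + m * (\<bar>a\<bar> + real m * \<bar>t\<bar>)\<^sup>2)\<^sup>2 * decay \<kappa> m t a \<le> C2 * cauchy_weight m t a"
      if "\<bar>t\<bar> \<le> pi" "\<bar>a\<bar> \<le> pi" for t a using weight[OF that] .
    have d0: "0 \<le> decay \<kappa> m t a" for t a by (simp add: decay_def)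

    have "\<bar>integral torus (\<lambda>(t, a). Re (integrand q m l n t a) - gauss q m t a)\<bar>
      \<le> (C1 + \<Delta>) * C2 / sqrt m * (pi\<^sup>2 / (real m)\<^sup>2)"
    proof (rule abs_integral_torus_le)
      show "continuous_on torus (\<lambda>(t, a). Re (integrand q m l n t a) - gauss q m t a)"
        unfolding case_prod_unfold by (intro continuous_intros q')
      fix t a :: real assume ta: "\<bar>t\<bar> \<le> pi" "\<bar>a\<bar> \<le> pi"
      define s where "s = \<bar>a\<bar> + real m * \<bar>t\<bar>"
      define w where "w = (1 + m * s\<^sup>2)\<^sup>2"
      have s0: "0 \<le> s" by (simp add: s_def)
      \<comment> \<open>\<open>y\<close> is \<open>s\<close> in units of its natural scale. The
        error becomes (C1 y^3 + \<open>\<Delta>\<close> y) / sqrt m, and both powers of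
        \<open>y\<close> are below w = (1 + y^2)^2.\<close>
      define y where "y = sqrt m * s"
      have y: "0 \<le> y" "m * s\<^sup>2 = y\<^sup>2" "s = y / sqrt m" using s0 m by (auto simp: y_def power_mult_distrib)
      have "y ^ 3 \<le> w" "y \<le> w"
      proof -
        have "y * 2 \<le> 1 + y\<^sup>2" using sum_squares_bound[of y 1] by simp
        then have 1: "y \<le> 1 + y\<^sup>2" using y by linarith
        have w: "w = (1 + y\<^sup>2) * (1 + y\<^sup>2)" unfolding w_def y(2) by (rule power2_eq_square)
        have "y * y\<^sup>2 \<le> (1 + y\<^sup>2) * (1 + y\<^sup>2)" using 1 y by (intro mult_mono) auto
        then show "y ^ 3 \<le> w" by (simp add: w power3_eq_cube power2_eq_square)
        have "y * 1 \<le> (1 + y\<^sup>2) * (1 + y\<^sup>2)" using 1 y by (intro mult_mono) auto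
        then show "y \<le> w" by (simp add: w)
      qed
      note yw = this
      have "\<bar>Re (integrand q m l n t a) - gauss q m t a\<bar> \<le> cmod (integrand q m l n t a - of_real (gauss q m t a))"
        using abs_Re_le_cmod[of "integrand q m l n t a - of_real (gauss q m t a)"] by simp
      also have "\<dots> \<le> (C1 * m * s ^ 3 + \<Delta> * s) * decay \<kappa> m t a"
        unfolding s_def by (rule approx[OF q m ta(2,1) l n])
      also have "C1 * m * s ^ 3 + \<Delta> * s = (C1 * y ^ 3 + \<Delta> * y) / sqrt m"
      proof -
        have "C1 * m * s ^ 3 = C1 * (m * s\<^sup>2) * s" by (simp add: power3_eq_cube power2_eq_square)
        then show ?thesis unfolding y(2) by (simp add: y(3) power3_eq_cube power2_eq_square add_divide_distrib)
      qed
      also have "\<dots> \<le> (C1 * w + \<Delta> * w) / sqrt m"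
        using yw C1 \<Delta>0 by (intro divide_right_mono add_mono mult_left_mono) auto
      also have "\<dots> = (C1 + \<Delta>) / sqrt m * w" by (simp add: add_divide_distrib distrib_right)
      finally have "\<bar>Re (integrand q m l n t a) - gauss q m t a\<bar> \<le> (C1 + \<Delta>) / sqrt m * (w * decay \<kappa> m t a)"
        using d0 by (simp add: mult_right_mono mult.assoc)
      also have "\<dots> \<le> (C1 + \<Delta>) / sqrt m * (C2 * cauchy_weight m t a)"
        unfolding w_def s_def using C1 \<Delta>0 by (intro mult_left_mono wbound ta) auto
      finally show "\<bar>Re (integrand q m l n t a) - gauss q m t a\<bar> \<le> (C1 + \<Delta>) * C2 / sqrt m * cauchy_weight m t a"
        by simp
    qed (use C1 C2 \<Delta>0 m in auto)
    moreover have "integral torus (\<lambda>(t, a). Re (integrand q m l n t a) - gauss q m t a)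
       = box_integral q m l n - integral torus (\<lambda>(t, a). gauss q m t a)"
      unfolding box_integral_def case_prod_unfold
      by (rule integral_diff) (use cont contg in \<open>auto intro!: integrable_on_torus simp: case_prod_unfold\<close>)
    moreover have "4 * c / (real m)\<^sup>2 \<le> integral torus (\<lambda>(t, a). gauss q m t a)"
      unfolding c_def using m by (intro integral_gauss_ge q') auto
    ultimately have "4 * c / (real m)\<^sup>2 - (C1 + \<Delta>) * C2 / sqrt m * (pi\<^sup>2 / (real m)\<^sup>2) \<le> box_integral q m l n"
      by linarith
    moreover have "(C1 + \<Delta>) * C2 / sqrt m * (pi\<^sup>2 / (real m)\<^sup>2) \<le> c / (real m)\<^sup>2"
    proof -
      have "C3 / c \<le> sqrt m" using mC by (intro real_le_rsqrt) auto
      then have "C3 / sqrt m \<le> c" using c m by (simp add: field_simps)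
      then have "C3 / sqrt m / (real m)\<^sup>2 \<le> c / (real m)\<^sup>2" by (intro divide_right_mono) auto
      then show ?thesis by (simp add: C3_def)
    qed
    moreover have "0 \<le> c / (real m)\<^sup>2" using c by simp
    ultimately show "c / (real m)\<^sup>2 \<le> box_integral q m l n" by simp

    have "\<bar>integral torus (\<lambda>(t, a). Re (integrand q m l (n + 1) t a) - Re (integrand q m l n t a))\<bar>
      \<le> (1 + C1 + \<Delta>) * C2 / (real m)\<^sup>2 * (pi\<^sup>2 / (real m)\<^sup>2)"
    proof (rule abs_integral_torus_le)
      show "continuous_on torus (\<lambda>(t, a). Re (integrand q m l (n + 1) t a) - Re (integrand q m l n t a))"
        unfolding case_prod_unfold by (intro continuous_intros q')
      fix t a :: real assume ta: "\<bar>t\<bar> \<le> pi" "\<bar>a\<bar> \<le> pi"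
      define s where "s = \<bar>a\<bar> + real m * \<bar>t\<bar>"
      define w where "w = (1 + m * s\<^sup>2)\<^sup>2"
      define \<psi> where "\<psi> = integrand q m l n t a"
      define d where "d = decay \<kappa> m t a"
      have s0: "0 \<le> s" by (simp add: s_def)
      have m0: "0 < real m" using m by simp
      have ts: "\<bar>t\<bar> \<le> s / m" using m by (simp add: s_def field_simps)
      have "integrand q m l (n + 1) t a = \<psi> * cis (- t)"
        by (simp add: \<psi>_def integrand_def mult.assoc cis_mult algebra_simps)
      \<comment> \<open>As \<open>gauss\<close> is real, Im \<open>\<psi>\<close> is itself an
        approximation error, while 1 - cos t is of second order. With |t| <= s/m both products
        become m^(-2) times polynomials in s^2 and m s^2 that are below \<open>w\<close>, up to
        constants.\<close>
      then have "Re (integrand q m l (n + 1) t a) - Re (integrand q m l n t a)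
        = - (Re \<psi> * (1 - cos t)) + Im \<psi> * sin t"
        by (simp add: \<psi>_def[symmetric] algebra_simps)
      also have "\<bar>\<dots>\<bar> \<le> \<bar>Re \<psi>\<bar> * \<bar>1 - cos t\<bar> + \<bar>Im \<psi>\<bar> * \<bar>sin t\<bar>"
        using abs_triangle_ineq[of "- (Re \<psi> * (1 - cos t))" "Im \<psi> * sin t"] by (simp add: abs_mult)
      also have "\<dots> \<le> d * t\<^sup>2 + ((C1 * m * s ^ 3 + \<Delta> * s) * d) * \<bar>t\<bar>"
      proof (intro add_mono mult_mono)
        show "\<bar>Re \<psi>\<bar> \<le> d"
          using abs_Re_le_cmod[of \<psi>] norm_integrand_le[of q m a t l n, OF q' m ta(2,1)] by (simp add: \<psi>_def d_def)
        have "\<bar>Im \<psi>\<bar> \<le> cmod (\<psi> - of_real (gauss q m t a))"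
          using abs_Im_le_cmod[of "\<psi> - of_real (gauss q m t a)"] by simp
        also have "\<dots> \<le> (C1 * m * s ^ 3 + \<Delta> * s) * d"
          unfolding s_def \<psi>_def d_def by (rule approx[OF q m ta(2,1) l n])
        finally show "\<bar>Im \<psi>\<bar> \<le> (C1 * m * s ^ 3 + \<Delta> * s) * d" .
        have "1 - cos t = 2 * (sin (t / 2))\<^sup>2" using cos_double_sin[of "t / 2"] by simp
        moreover have "\<bar>sin (t / 2)\<bar>\<^sup>2 \<le> \<bar>t / 2\<bar>\<^sup>2" by (intro power_mono abs_sin_x_le_abs_x) auto
        then have "4 * (sin (t / 2))\<^sup>2 \<le> t\<^sup>2" by (simp add: power_divide)
        moreover have "0 \<le> (sin (t / 2))\<^sup>2" by simp
        ultimately show "\<bar>1 - cos t\<bar> \<le> t\<^sup>2" by linarith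
        show "\<bar>sin t\<bar> \<le> \<bar>t\<bar>" by (rule abs_sin_x_le_abs_x)
      qed (use C1 \<Delta>0 s0 in \<open>auto simp: d_def decay_def\<close>)
      also have "\<dots> \<le> d * (s / m)\<^sup>2 + ((C1 * m * s ^ 3 + \<Delta> * s) * d) * (s / m)"
        using ts power_mono[OF ts, of 2] C1 \<Delta>0 s0 by (intro add_mono mult_left_mono) (auto simp: d_def decay_def)
      also have "\<dots> = (s\<^sup>2 + C1 * (m * s\<^sup>2)\<^sup>2 + \<Delta> * (m * s\<^sup>2)) / (real m)\<^sup>2 * d"
        using m0 by (simp add: field_simps power2_eq_square power3_eq_cube)
      also have "\<dots> \<le> (w + C1 * w + \<Delta> * w) / (real m)\<^sup>2 * d"
      proof (intro mult_right_mono divide_right_mono add_mono mult_left_mono)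
        have "1 * s\<^sup>2 \<le> m * s\<^sup>2" using m by (intro mult_right_mono) auto
        moreover have ww: "w = 1 + 2 * (m * s\<^sup>2) + (m * s\<^sup>2)\<^sup>2" by (simp add: w_def power2_sum)
        moreover have "0 \<le> m * s\<^sup>2" "0 \<le> (m * s\<^sup>2)\<^sup>2" by simp_all
        ultimately show "s\<^sup>2 \<le> w" "m * s\<^sup>2 \<le> w" "(m * s\<^sup>2)\<^sup>2 \<le> w" by linarith+
      qed (use C1 \<Delta>0 in \<open>auto simp: d_def decay_def\<close>)
      also have "\<dots> = (1 + C1 + \<Delta>) / (real m)\<^sup>2 * (w * d)" by (simp add: distrib_right)
      also have "\<dots> \<le> (1 + C1 + \<Delta>) / (real m)\<^sup>2 * (C2 * cauchy_weight m t a)"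
        unfolding w_def s_def d_def using C1 \<Delta>0 by (intro mult_left_mono wbound ta) auto
      finally show "\<bar>Re (integrand q m l (n + 1) t a) - Re (integrand q m l n t a)\<bar>
        \<le> (1 + C1 + \<Delta>) * C2 / (real m)\<^sup>2 * cauchy_weight m t a" by simp
    qed (use C1 C2 \<Delta>0 m in auto)
    moreover have "integral torus (\<lambda>(t, a). Re (integrand q m l (n + 1) t a) - Re (integrand q m l n t a))
       = box_integral q m l (n + 1) - box_integral q m l n"
      unfolding box_integral_def case_prod_unfold
      by (rule integral_diff) (use cont in \<open>auto intro!: integrable_on_torus simp: case_prod_unfold\<close>)
    ultimately show "\<bar>box_integral q m l (n + 1) - box_integral q m l n\<bar> \<le> C4 / (real m) ^ 4"
      by (simp add: C4_def power4_eq_xxxx power2_eq_square mult_ac)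
  qed
  then show ?thesis using c C34 by blast
qed

end

section \<open>The parameters\<close>

definition bose :: "real \<Rightarrow> real" where
  "bose y = 1 / (exp y - 1)"

lemma continuous_on_bose [continuous_intros]:
  assumes "continuous_on S f" "\<And>x. x \<in> S \<Longrightarrow> 0 < f x"
  shows "continuous_on S (\<lambda>x. bose (f x))"
  unfolding bose_def using assms by (force intro!: continuous_intros)

lemma bose_less: "0 < x \<Longrightarrow> x < y \<Longrightarrow> bose y < bose x"
  unfolding bose_def by (intro divide_strict_left_mono mult_pos_pos) auto

lemma bose_le_inverse:
  assumes "0 < y"
  shows "bose y \<le> 1 / y"
proof -
  have "y \<le> exp y - 1" using exp_ge_add_one_self[of y] by linarith
  then show ?thesis unfolding bose_def using assms by (intro divide_left_mono) auto
qed

lemma one_plus_bose: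
  assumes "0 < y"
  shows "1 / (1 - exp (- y)) = 1 + bose y"
  using assms by (simp add: bose_def exp_minus field_simps)

lemma exp_minus_one_le: "exp x - 1 \<le> x * exp (x :: real)"
proof -
  have "(1 - x) * exp x \<le> exp (- x) * exp x"
    using exp_ge_add_one_self[of "- x"] by (intro mult_right_mono) auto
  then show ?thesis by (simp add: algebra_simps flip: exp_add)
qed

text \<open>The derivative of \<open>bose\<close> is - bose (1 + bose), and bose <= 1/w. The
  hypotheses bound exp x - 1 rather than x, since that is the quantity which the parameter equations
  control.\<close>

lemma bose_Lipschitz:
  assumes w: "0 < w" and x: "w \<le> exp x - 1" and y: "w \<le> exp y - 1"
  shows "\<bar>bose x - bose y\<bar> \<le> (1 + 1 / w) / w * \<bar>x - y\<bar>"
proof -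
  have main: "bose x - bose y \<le> (1 + 1 / w) / w * (y - x)" "bose y \<le> bose x"
    if w: "0 < w" and x: "w \<le> exp x - 1" and xy: "x \<le> y" for x y
  proof -
    have exy: "exp x \<le> exp y" using xy by simp
    then have pos: "0 < exp x - 1" "0 < exp y - 1" "w \<le> exp y - 1" using w x by linarith+
    have "exp y - exp x = (exp (y - x) - 1) * exp x"
      by (simp add: left_diff_distrib flip: exp_add)
    also have "\<dots> \<le> (y - x) * exp (y - x) * exp x"
      by (intro mult_right_mono exp_minus_one_le) auto
    also have "\<dots> = (y - x) * exp y" by (simp add: mult.assoc flip: exp_add)
    finally have "(exp y - exp x) / ((exp x - 1) * (exp y - 1)) \<le> (y - x) * exp y / ((exp x - 1) * (exp y - 1))"
      using pos by (intro divide_right_mono) auto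
    also have "\<dots> = (1 + 1 / (exp y - 1)) / (exp x - 1) * (y - x)"
      using pos by (simp add: field_simps)
    also have "\<dots> \<le> (1 + 1 / w) / w * (y - x)"
      using pos x w xy by (intro mult_right_mono frac_le add_left_mono) auto
    also have "(exp y - exp x) / ((exp x - 1) * (exp y - 1)) = bose x - bose y"
      using pos by (simp add: bose_def field_simps)
    finally show "bose x - bose y \<le> (1 + 1 / w) / w * (y - x)" .
    show "bose y \<le> bose x"
      unfolding bose_def using pos exy by (intro divide_left_mono) auto
  qed
  show ?thesis
    using main[OF w x, of y] main[OF w y, of x] by (cases "x \<le> y") auto
qed

lemma bose_le:
  assumes "0 < w" "w \<le> exp y - 1"
  shows "0 \<le> bose y" "bose y \<le> 1 / w"
proof -
  have pos: "0 < exp y - 1" using assms by linarith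
  then show "0 \<le> bose y" unfolding bose_def by (intro divide_nonneg_pos) auto
  show "bose y \<le> 1 / w" unfolding bose_def by (intro divide_left_mono mult_pos_pos assms pos) auto
qed

section \<open>Uniqueness, bounds and existence of the parameters\<close>

lemma add_mult_pos: "0 < c \<Longrightarrow> 0 \<le> d \<Longrightarrow> t \<in> {0..1} \<Longrightarrow> 0 < c + d * (t :: real)"
  by (intro add_pos_nonneg) auto

lemma integrable_bose:
  assumes "0 < c" "0 \<le> d"
  shows "(\<lambda>t. bose (c + d * t)) integrable_on {0..1}" "(\<lambda>t. t * bose (c + d * t)) integrable_on {0..1}"
  using assms by (auto intro!: integrable_continuous_interval continuous_intros add_mult_pos)

text \<open>Since 1 / (1 - exp(-y)) = 1 + bose y, the constants 1 and 1/2 are the integrals of 1 and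
  t, and A and B become continuous versions of the scaled means.\<close>

lemma is_parameter_pair_iff:
  "is_parameter_pair A B c d \<longleftrightarrow> 0 < c \<and> 0 < d \<and>
     A = integral {0..1} (\<lambda>t. bose (c + d * t)) \<and> B = integral {0..1} (\<lambda>t. t * bose (c + d * t))"
proof (cases "0 < c \<and> 0 < d")
  case True
  have eq: "1 / (1 - exp (- c - d * t)) = 1 + bose (c + d * t)" if "t \<in> {0..1}" for t
    using one_plus_bose[OF add_mult_pos[of c d t]] that True by simp
  have "integral {0..1} (\<lambda>t. 1 / (1 - exp (- c - d * t))) = integral {0..1} (\<lambda>t. 1 + bose (c + d * t))"
    by (rule integral_cong) (rule eq)
  also have "\<dots> = 1 + integral {0..1} (\<lambda>t. bose (c + d * t))"
    using True by (subst integral_add) (auto intro!: integrable_bose)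
  finally have 1: "integral {0..1} (\<lambda>t. 1 / (1 - exp (- c - d * t))) = \<dots>" .
  have "integral {0..1} (\<lambda>t. t / (1 - exp (- c - d * t))) = integral {0..1} (\<lambda>t. t + t * bose (c + d * t))"
  proof (rule integral_cong)
    fix t :: real assume "t \<in> {0..1}"
    have "t / (1 - exp (- c - d * t)) = t * (1 / (1 - exp (- c - d * t)))" by simp
    then show "t / (1 - exp (- c - d * t)) = t + t * bose (c + d * t)"
      unfolding eq[OF \<open>t \<in> {0..1}\<close>] by (simp add: distrib_left)
  qed
  also have "\<dots> = integral {0..1} (\<lambda>t. t) + integral {0..1} (\<lambda>t. t * bose (c + d * t))"
    using True by (intro integral_add integrable_bose) (auto intro!: integrable_continuous_interval continuous_intros)
  also have "integral {0..1} (\<lambda>t::real. t) = 1 / 2"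
    using integral_ident[of 0 1] by simp
  finally show ?thesis using 1 True unfolding is_parameter_pair_def by auto
qed (auto simp: is_parameter_pair_def)

text \<open>Uniqueness expresses the strict convexity of the logarithmic partition function
  \<open>(c, d) \<mapsto> - \<integral> ln (1 - exp (- c - d t)) dt\<close>, whose gradient is \<open>(- A, - B)\<close>.\<close>

lemma is_parameter_pair_unique:
  assumes 1: "is_parameter_pair A B c d" and 2: "is_parameter_pair A B c' d'"
  shows "c = c' \<and> d = d'"
proof -
  have pos: "0 < c" "0 < d" "0 < c'" "0 < d'" using 1 2 by (auto simp: is_parameter_pair_def)
  let ?g = "\<lambda>t. bose (c + d * t)" and ?g' = "\<lambda>t. bose (c' + d' * t)"
  let ?F = "\<lambda>t. (?g' t - ?g t) * ((c + d * t) - (c' + d' * t))"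
  have int: "?g integrable_on {0..1}" "?g' integrable_on {0..1}"
    "(\<lambda>t. t * ?g t) integrable_on {0..1}" "(\<lambda>t. t * ?g' t) integrable_on {0..1}"
    using pos by (auto intro!: integrable_bose)
  have F: "?F = (\<lambda>t. (c - c') * (?g' t - ?g t) + (d - d') * (t * ?g' t - t * ?g t))"
    by (auto simp: algebra_simps)
  have "integral {0..1} ?F = (c - c') * (integral {0..1} ?g' - integral {0..1} ?g)
    + (d - d') * (integral {0..1} (\<lambda>t. t * ?g' t) - integral {0..1} (\<lambda>t. t * ?g t))"
    unfolding F using int
    by (simp add: integral_add integral_diff integrable_on_mult_right integrable_diff integral_mult_right)
  also have "\<dots> = 0" using 1 2 by (simp add: is_parameter_pair_iff)
  finally have "integral {0..1} ?F = 0" .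
  moreover have "continuous_on {0..1} ?F"
    using pos by (intro continuous_intros add_mult_pos) auto
  moreover have nonneg: "0 \<le> ?F t" if "t \<in> {0..1}" for t
    using bose_less[of "c + d * t" "c' + d' * t"] bose_less[of "c' + d' * t" "c + d * t"]
      add_mult_pos[of c d t] add_mult_pos[of c' d' t] pos that
    by (cases "c + d * t" "c' + d' * t" rule: linorder_cases) (auto intro: mult_nonneg_nonneg mult_nonpos_nonpos)
  ultimately have "\<forall>t\<in>{0..1}. ?F t = 0"
    using integral_eq_0_iff[of 0 1 ?F] by auto
  then have "c + d * t = c' + d' * t" if "t \<in> {0..1}" for t
    using bose_less[of "c + d * t" "c' + d' * t"] bose_less[of "c' + d' * t" "c + d * t"]
      add_mult_pos[of c d t] add_mult_pos[of c' d' t] pos that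
    by (cases "c + d * t" "c' + d' * t" rule: linorder_cases) force+
  from this[of 0] this[of 1] show ?thesis by auto
qed

text \<open>The antiderivative is ln(1 - exp(-(c + d t))) / d. Solved for exp c, the identity
  expresses c through d and A, so only one unknown remains.\<close>

lemma integral_bose_identity:
  assumes c: "0 < c" and d: "0 < d" and A: "A = integral {0..1} (\<lambda>t. bose (c + d * t))"
  shows "(exp (d * A) - 1) * (exp c - 1) = 1 - exp (- d)"
proof -
  have "((\<lambda>t. bose (c + d * t)) has_integral ln (1 - exp (- (c + d * 1))) / d - ln (1 - exp (- (c + d * 0))) / d) {0..1}"
  proof (rule fundamental_theorem_of_calculus)
    fix t :: real assume "t \<in> {0..1}"
    then have y: "0 < c + d * t" using c d by (intro add_mult_pos) auto
    have "((\<lambda>t. ln (1 - exp (- (c + d * t))) / d) has_real_derivative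
       (1 / (1 - exp (- (c + d * t))) * (exp (- (c + d * t)) * d)) / d) (at t within {0..1})"
      by (rule derivative_eq_intros refl | use y d in simp)+
    also have "(1 / (1 - exp (- (c + d * t))) * (exp (- (c + d * t)) * d)) / d = bose (c + d * t)"
    proof -
      have "1 - exp (- (c + d * t)) \<noteq> 0" using y by simp
      then have "(1 / (1 - exp (- (c + d * t))) * (exp (- (c + d * t)) * d)) / d = 1 / (1 - exp (- (c + d * t))) - 1"
        using d by (simp add: field_simps)
      then show ?thesis using one_plus_bose[OF y] by linarith
    qed
    finally show "((\<lambda>t. ln (1 - exp (- (c + d * t))) / d) has_vector_derivative bose (c + d * t)) (at t within {0..1})"
      by (simp add: has_real_derivative_iff_has_vector_derivative)
  qed simp
  then have "d * A = ln (1 - exp (- c - d)) - ln (1 - exp (- c))"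
    using d by (simp add: A integral_unique field_simps)
  then have "exp (d * A) = (1 - exp (- c - d)) / (1 - exp (- c))"
    using c d by (simp add: exp_diff)
  moreover have "1 - exp (- c) \<noteq> 0" using c by simp
  ultimately have "exp (d * A) * (1 - exp (- c)) = 1 - exp (- c - d)" by (simp add: field_simps)
  then have "exp (d * A) * (1 - exp (- c)) * exp c = (1 - exp (- c - d)) * exp c" by simp
  then have "exp (d * A) * (exp c - 1) = exp c - exp (- d)"
    by (simp add: algebra_simps flip: exp_add)
  then show ?thesis by (simp add: algebra_simps)
qed

text \<open>Both 1 - exp(-d) and exp(d A) - 1 vanish to first order at d = 0, so their quotient exp
  c - 1 stays between positive bounds although d has no lower bound.\<close>

lemma parameter_c_bounds:
  fixes c d D A a :: real
  assumes c: "0 < c" and d: "0 < d" "d \<le> D" and A: "0 < A" "A \<le> a"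
    and id: "(exp (d * A) - 1) * (exp c - 1) = 1 - exp (- d)"
  shows "exp (- (D * (1 + a))) / a \<le> exp c - 1" "exp c - 1 \<le> 1 / A"
proof -
  have dA: "0 < d * A" by (rule mult_pos_pos[OF d(1) A(1)])
  have "exp c - 1 = (1 - exp (- d)) / (exp (d * A) - 1)"
  proof -
    have "exp (d * A) - 1 \<noteq> 0" using d A by auto
    then show ?thesis using id by (simp add: eq_divide_eq mult.commute)
  qed
  moreover have "d * exp (- d) / (d * A * exp (d * A)) \<le> (1 - exp (- d)) / (exp (d * A) - 1)"
    using exp_minus_one_le[of "- d"] exp_minus_one_le[of "d * A"] d dA by (intro frac_le) auto
  moreover have "(1 - exp (- d)) / (exp (d * A) - 1) \<le> d / (d * A)"
  proof -
    have "d * A \<le> exp (d * A) - 1" "1 - exp (- d) \<le> d"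
      using exp_ge_add_one_self[of "- d"] exp_ge_add_one_self[of "d * A"] by linarith+
    then show ?thesis using d dA by (intro frac_le) auto
  qed
  moreover have "exp (- (D * (1 + a))) / a \<le> d * exp (- d) / (d * A * exp (d * A))"
  proof -
    have "d * (1 + A) \<le> D * (1 + a)" using d A by (intro mult_mono) auto
    then have "exp (- (D * (1 + a))) / a \<le> exp (- (d * (1 + A))) / A"
      using A by (intro frac_le) auto
    also have "\<dots> = d * exp (- d) / (d * A * exp (d * A))"
    proof -
      have "exp (- (d * (1 + A))) = exp (- d) / exp (d * A)"
        by (simp add: distrib_left flip: exp_diff)
      then show ?thesis using d by simp
    qed
    finally show ?thesis .
  qed
  ultimately show "exp (- (D * (1 + a))) / a \<le> exp c - 1" "exp c - 1 \<le> 1 / A" using d by auto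
qed

text \<open>From bose y <= 1/y. Read as d <= 1/B, it is the upper bound for d.\<close>

lemma integral_moment_bose_le:
  assumes "0 < c" "0 < d"
  shows "integral {0..1} (\<lambda>t. t * bose (c + d * t)) \<le> 1 / d"
proof -
  have "integral {0..1} (\<lambda>t. t * bose (c + d * t)) \<le> integral {0..1} (\<lambda>t::real. 1 / d)"
  proof (intro integral_le integrable_bose)
    fix t :: real assume t: "t \<in> {0..1}"
    have "t * bose (c + d * t) \<le> t * (1 / (c + d * t))"
      using t assms by (intro mult_left_mono bose_le_inverse add_mult_pos) auto
    also have "\<dots> \<le> 1 / d"
      using add_mult_pos[of c d t] t assms by (simp add: field_simps)
    finally show "t * bose (c + d * t) \<le> 1 / d" .
  qed (use assms in auto)
  then show ?thesis by simp
qed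

text \<open>The left side is the integral of (1/2 - t) bose(c + d t). As 1/2 - t has integral 0, the
  value at t = 1/2 may be subtracted, and the Lipschitz bound leaves O(d). This turns a large gap m
  (A/2 - B) into a large m d, and also starts the existence proof.\<close>

lemma integral_bose_defect_le:
  assumes c: "0 < c" and d: "0 \<le> d" and w: "0 < w" "w \<le> exp c - 1"
  shows "integral {0..1} (\<lambda>t. bose (c + d * t)) / 2 - integral {0..1} (\<lambda>t. t * bose (c + d * t))
    \<le> (1 + 1 / w) / w * d"
proof -
  let ?g = "\<lambda>t. bose (c + d * t)"
  let ?b = "bose (c + d * (1/2))"
  have int: "?g integrable_on {0..1}" "(\<lambda>t. t * ?g t) integrable_on {0..1}"
    using c d by (auto intro!: integrable_bose)
  have lin: "((\<lambda>t. (1 / 2 - t) * ?b) has_integral 0) {0..1}"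
  proof -
    have "((\<lambda>t::real. (1 / 2 - t) * ?b) has_integral (1 / 2 * 1 - 1\<^sup>2 / 2) * ?b - (1 / 2 * 0 - 0\<^sup>2 / 2) * ?b) {0..1}"
    proof (rule fundamental_theorem_of_calculus)
      fix t :: real
      show "((\<lambda>t. (1 / 2 * t - t\<^sup>2 / 2) * ?b) has_vector_derivative (1 / 2 - t) * ?b) (at t within {0..1})"
        unfolding has_real_derivative_iff_has_vector_derivative[symmetric]
        by (rule derivative_eq_intros refl | simp)+
    qed simp
    then show ?thesis by simp
  qed
  have "integral {0..1} ?g / 2 - integral {0..1} (\<lambda>t. t * ?g t) = integral {0..1} (\<lambda>t. ?g t / 2 - t * ?g t - (1 / 2 - t) * ?b)"
    using int lin by (simp add: integral_diff integrable_diff has_integral_iff integrable_on_divide)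
  also have "\<dots> \<le> integral {0..1} (\<lambda>t::real. (1 + 1 / w) / w * d)"
  proof (rule integral_le)
    show "(\<lambda>t. ?g t / 2 - t * ?g t - (1 / 2 - t) * ?b) integrable_on {0..1}"
      using int lin by (intro integrable_diff integrable_on_divide) auto
    fix t :: real assume t: "t \<in> {0..1}"
    have "exp c \<le> exp (c + d * u)" if "u \<in> {0..1}" for u :: real using that d by simp
    then have "w \<le> exp (c + d * t) - 1" "w \<le> exp (c + d * (1 / 2)) - 1"
      using w t by (smt (verit) atLeastAtMost_iff divide_le_eq_1 zero_le_divide_1_iff)+
    note lip0 = bose_Lipschitz[OF w(1) this]
    have lip: "\<bar>?g t - ?b\<bar> \<le> (1 + 1 / w) / w * (d * \<bar>t - 1 / 2\<bar>)"
    proof -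
      have "\<bar>(c + d * t) - (c + d * (1 / 2))\<bar> = \<bar>d * (t - 1 / 2)\<bar>" by (simp add: algebra_simps)
      also have "\<dots> = d * \<bar>t - 1 / 2\<bar>" using d by (simp add: abs_mult)
      finally have eq: "\<bar>(c + d * t) - (c + d * (1 / 2))\<bar> = d * \<bar>t - 1 / 2\<bar>" .
      show ?thesis using lip0 unfolding eq .
    qed
    have "?g t / 2 - t * ?g t - (1 / 2 - t) * ?b = (1 / 2 - t) * (?g t - ?b)"
      by (simp add: algebra_simps)
    also have "\<dots> \<le> \<bar>1 / 2 - t\<bar> * \<bar>?g t - ?b\<bar>" unfolding abs_mult[symmetric] by (rule abs_ge_self)
    also have "\<dots> \<le> 1 * ((1 + 1 / w) / w * (d * 1))"
      using t w d by (intro mult_mono order.trans[OF lip] mult_left_mono) auto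
    finally show "?g t / 2 - t * ?g t - (1 / 2 - t) * ?b \<le> (1 + 1 / w) / w * d" by simp
  qed auto
  also have "\<dots> = (1 + 1 / w) / w * d" by simp
  finally show ?thesis .
qed

text \<open>\<open>f d\<close> is the c that \<open>integral_bose_identity\<close> forces, so the
  equation for A holds along the curve (f d, d). The intermediate value theorem then solves G d =
  B.\<close>

lemma parameter_pair_exists:
  assumes AB: "A > 2 * B" and B: "B > 0"
  shows "\<exists>c d. is_parameter_pair A B c d"
proof -
  have A: "A > 0" using AB B by linarith
  define f where "f = (\<lambda>d. ln (1 + (1 - exp (- d)) / (exp (d * A) - 1)))"
  define G where "G = (\<lambda>d. integral (cbox 0 1) (\<lambda>t. t * bose (f d + d * t)))"
  have ratio: "0 < (1 - exp (- d)) / (exp (d * A) - 1)" if "0 < d" for d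
    using that A by (intro divide_pos_pos) auto
  have f0: "0 < f d" if "0 < d" for d using ratio[OF that] by (simp add: f_def)
  have f_id: "(exp (d * A) - 1) * (exp (f d) - 1) = 1 - exp (- d)" if "0 < d" for d
  proof -
    have "exp (f d) = 1 + (1 - exp (- d)) / (exp (d * A) - 1)"
      using ratio[OF that] by (simp add: f_def)
    moreover have "exp (d * A) - 1 \<noteq> 0" using that A by simp
    ultimately show ?thesis by simp
  qed
  have A_eq: "A = integral {0..1} (\<lambda>t. bose (f d + d * t))" if d: "0 < d" for d
  proof -
    define A' where "A' = integral {0..1} (\<lambda>t. bose (f d + d * t))"
    have "(exp (d * A') - 1) * (exp (f d) - 1) = (exp (d * A) - 1) * (exp (f d) - 1)"
      using integral_bose_identity[OF f0[OF d] d A'_def] f_id[OF d] by simp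
    then have "exp (d * A') = exp (d * A)" using f0[OF d] by simp
    then show ?thesis using d by (simp add: A'_def)
  qed
  define w where "w = exp (- (1 * (1 + A))) / A"
  define L where "L = (1 + 1 / w) / w"
  have w: "0 < w" using A by (simp add: w_def)
  then have L: "0 < L" by (simp add: L_def add_pos_pos)
  \<comment> \<open>At \<open>d1\<close> the defect A/2 - G is at most L d1 <= A/2 - B, so G >= B;
    the cap 1 lets \<open>w\<close> serve as the bound for exp(f d1) - 1. At \<open>d2\<close> >=
    1/B one has G <= 1/d2 <= B.\<close>
  define d1 where "d1 = min 1 ((A / 2 - B) / L)"
  define d2 where "d2 = max d1 (1 / B)"
  have d1: "0 < d1" "d1 \<le> 1" "d1 \<le> (A / 2 - B) / L" using AB L by (auto simp: d1_def)
  have "w \<le> exp (f d1) - 1"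
    unfolding w_def by (rule parameter_c_bounds[OF f0[OF d1(1)] d1(1,2) A order.refl f_id[OF d1(1)]])
  then have "A / 2 - G d1 \<le> L * d1"
    using integral_bose_defect_le[OF f0[OF d1(1)] _ w] A_eq[OF d1(1)] d1 by (simp add: G_def L_def)
  moreover have "L * d1 \<le> A / 2 - B" using d1(3) L by (simp add: field_simps)
  ultimately have G1: "B \<le> G d1" by linarith
  have d2: "0 < d2" "d1 \<le> d2" "1 / B \<le> d2" using d1 by (auto simp: d2_def)
  have "G d2 \<le> 1 / d2" using integral_moment_bose_le[OF f0[OF d2(1)] d2(1)] by (simp add: G_def)
  also have "\<dots> \<le> B" using d2 B by (simp add: field_simps)
  finally have G2: "G d2 \<le> B" .
  have "continuous_on {d1..d2} G"
    unfolding G_def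
  proof (rule integral_continuous_on_param)
    have cf: "continuous_on ({d1..d2} \<times> (cbox 0 1 :: real set)) (\<lambda>p. f (fst p))"
      unfolding f_def
    proof (intro continuous_intros ballI)
      fix p :: "real \<times> real" assume "p \<in> {d1..d2} \<times> cbox 0 1"
      then have "0 < fst p" using d1 by auto
      then show "exp (fst p * A) - 1 \<noteq> 0" "1 + (1 - exp (- fst p)) / (exp (fst p * A) - 1) \<noteq> 0"
        using A ratio[of "fst p"] by (simp, linarith)
    qed
    show "continuous_on ({d1..d2} \<times> cbox 0 1) (\<lambda>(d, t). t * bose (f d + d * t))"
      unfolding case_prod_unfold
    proof (intro continuous_intros cf)
      fix p :: "real \<times> real" assume p: "p \<in> {d1..d2} \<times> cbox 0 1"
      then have "0 < fst p" using d1 by auto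
      then show "0 < f (fst p) + fst p * snd p"
        using p f0 by (intro add_mult_pos) auto
    qed
  qed
  then obtain d where d: "d1 \<le> d" "d \<le> d2" "G d = B"
    using IVT2'[of G d2 B d1] G1 G2 d2 by auto
  then have "0 < d" using d1 by linarith
  then have "is_parameter_pair A B (f d) d"
    using A_eq[of d] f0[of d] d by (simp add: is_parameter_pair_iff G_def)
  then show ?thesis by blast
qed

lemma parameter_d_pair:
  assumes "A > 2 * B" "B > 0"
  obtains c where "is_parameter_pair A B c (parameter_d A B)"
proof -
  obtain c d where cd: "is_parameter_pair A B c d" using parameter_pair_exists[OF assms] by blast
  have "(THE p. is_parameter_pair A B (fst p) (snd p)) = (c, d)"
  proof (rule the_equality)
    show "is_parameter_pair A B (fst (c, d)) (snd (c, d))" using cd by simp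
    fix p assume "is_parameter_pair A B (fst p) (snd p)"
    from is_parameter_pair_unique[OF cd this] show "p = (c, d)" by (simp add: prod_eq_iff)
  qed
  then have "parameter_d A B = d" using assms by (simp add: parameter_d_def parameter_pair_def)
  then show ?thesis using cd that by blast
qed

section \<open>Means as sums compared with the integral equations\<close>

text \<open>Each of the m cells of the left-endpoint rule costs L / m^2, which sums to L after
  scaling by m. The sum has m + 1 terms, and the extra f 1 costs K.\<close>

lemma Riemann_sum_error:
  fixes f :: "real \<Rightarrow> real"
  assumes lip: "\<And>x y. x \<in> {0..1} \<Longrightarrow> y \<in> {0..1} \<Longrightarrow> \<bar>f x - f y\<bar> \<le> L * \<bar>x - y\<bar>"
    and bound: "\<bar>f 1\<bar> \<le> K" and m: "0 < m"
  shows "\<bar>(\<Sum>j<Suc m. f (real j / m)) - m * integral {0..1} f\<bar> \<le> L + K"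
proof -
  have m0: "0 < real m" using m by simp
  have L: "0 \<le> L" using lip[of 0 1] by simp
  have cont: "continuous_on {0..1} f"
  proof (rule continuous_onI)
    fix x e :: real assume x: "x \<in> {0..1}" and e: "0 < e"
    have "dist (f y) (f x) \<le> e" if "y \<in> {0..1}" "dist y x < e / (L + 1)" for y
    proof -
      have "dist (f y) (f x) \<le> L * dist y x" using lip[OF that(1) x] by (simp add: dist_real_def)
      also have "\<dots> \<le> (L + 1) * dist y x" by (simp add: algebra_simps)
      also have "\<dots> \<le> e" using that(2) L by (simp add: field_simps)
      finally show ?thesis .
    qed
    then show "\<exists>d>0. \<forall>x'\<in>{0..1}. dist x' x < d \<longrightarrow> dist (f x') (f x) \<le> e"
      using e L by (intro exI[of _ "e / (L + 1)"]) auto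
  qed
  have "\<bar>integral {0..k / m} f - (\<Sum>j<k. f (real j / m)) / m\<bar> \<le> k * (L / m\<^sup>2)" if "k \<le> m" for k :: nat
    using that
  proof (induction k)
    case (Suc k)
    define a where "a = real k / m"
    define b where "b = real (Suc k) / m"
    have ab: "0 \<le> a" "a \<le> b" "b \<le> 1" "b - a = 1 / m"
      using Suc.prems m0 by (auto simp: a_def b_def field_simps)
    have int: "f integrable_on {0..b}" "f integrable_on {a..b}"
      using ab by (auto intro!: integrable_continuous_interval continuous_on_subset[OF cont])
    have "norm (integral {a..b} (\<lambda>x. f x - f a)) \<le> L / m * (b - a)"
    proof (rule integral_bound)
      fix x assume x: "x \<in> {a..b}"
      then have "norm (f x - f a) \<le> L * \<bar>x - a\<bar>" using lip[of x a] ab by simp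
      also have "\<dots> \<le> L * (1 / m)" using x ab L by (intro mult_left_mono) auto
      finally show "norm (f x - f a) \<le> L / m" by simp
    qed (use ab in \<open>auto intro!: continuous_intros continuous_on_subset[OF cont]\<close>)
    moreover have "integral {a..b} (\<lambda>x. f x - f a) = integral {a..b} f - f a / m"
      using int ab by (subst integral_diff) auto
    moreover have "integral {0..b} f = integral {0..a} f + integral {a..b} f"
      using Henstock_Kurzweil_Integration.integral_combine[OF ab(1,2) int(1)] by simp
    moreover have "L / m * (b - a) = L / m\<^sup>2" by (simp add: ab power2_eq_square)
    moreover have "\<bar>integral {0..a} f - (\<Sum>j<k. f (real j / m)) / m\<bar> \<le> k * (L / m\<^sup>2)"
      using Suc by (simp add: a_def)
    moreover have "(\<Sum>j<Suc k. f (real j / m)) / m = (\<Sum>j<k. f (real j / m)) / m + f a / m"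
      by (simp add: a_def add_divide_distrib)
    moreover have "real (Suc k) * (L / m\<^sup>2) = k * (L / m\<^sup>2) + L / m\<^sup>2" by (simp add: distrib_right add_divide_distrib)
    ultimately show ?case unfolding b_def[symmetric] real_norm_def by linarith
  qed simp
  from this[of m] have "\<bar>integral {0..1} f - (\<Sum>j<m. f (real j / m)) / m\<bar> \<le> L / m"
    using m by (simp add: power2_eq_square)
  then have "m * \<bar>integral {0..1} f - (\<Sum>j<m. f (real j / m)) / m\<bar> \<le> m * (L / m)"
    by (intro mult_left_mono) auto
  also have "m * \<bar>integral {0..1} f - (\<Sum>j<m. f (real j / m)) / m\<bar> = \<bar>m * integral {0..1} f - (\<Sum>j<m. f (real j / m))\<bar>"
    using m by (simp add: abs_mult_pos' right_diff_distrib)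
  also have "m * (L / m) = L" using m by simp
  finally show ?thesis using bound m by simp
qed

text \<open>In \<open>\<Delta>\<close>, one 1/w pays for the extra endpoint; the other comes from
  the factor t, which adds the supremum of \<open>bose\<close> to the Lipschitz constant of the
  second integrand.\<close>

lemma bose_sums_error:
  assumes c: "0 < c" and d: "0 \<le> d" "d \<le> D" and w: "0 < w" "w \<le> exp c - 1" and m: "0 < m"
  defines "\<Delta> \<equiv> (1 + 1 / w) / w * D + 2 / w"
  shows "\<bar>(\<Sum>j<Suc m. bose (c + d * (real j / m))) - m * integral {0..1} (\<lambda>t. bose (c + d * t))\<bar> \<le> \<Delta>"
    and "\<bar>(\<Sum>j<Suc m. j * bose (c + d * (real j / m))) - (real m)\<^sup>2 * integral {0..1} (\<lambda>t. t * bose (c + d * t))\<bar> \<le> \<Delta> * m"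
proof -
  define L where "L = (1 + 1 / w) / w"
  have L: "0 < L" using w by (simp add: L_def add_pos_pos)
  have wt: "w \<le> exp (c + d * t) - 1" if "t \<in> {0..1}" for t
  proof -
    have "exp c \<le> exp (c + d * t)" using that d by simp
    then show ?thesis using w by linarith
  qed
  have lip: "\<bar>bose (c + d * x) - bose (c + d * y)\<bar> \<le> (L * D) * \<bar>x - y\<bar>"
    if "x \<in> {0..1}" "y \<in> {0..1}" for x y
  proof -
    have "\<bar>bose (c + d * x) - bose (c + d * y)\<bar> \<le> L * \<bar>(c + d * x) - (c + d * y)\<bar>"
      unfolding L_def by (rule bose_Lipschitz[OF w(1) wt[OF that(1)] wt[OF that(2)]])
    also have "(c + d * x) - (c + d * y) = d * (x - y)" by (simp add: algebra_simps)
    also have "L * \<bar>d * (x - y)\<bar> = L * (d * \<bar>x - y\<bar>)" using d by (simp add: abs_mult)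
    also have "\<dots> \<le> L * (D * \<bar>x - y\<bar>)" using L d by (intro mult_left_mono mult_right_mono) auto
    finally show ?thesis by simp
  qed
  have bd: "\<bar>bose (c + d * x)\<bar> \<le> 1 / w" if "x \<in> {0..1}" for x
    using bose_le[OF w(1) wt[OF that]] by simp
  have "\<bar>(\<Sum>j<Suc m. bose (c + d * (real j / m))) - m * integral {0..1} (\<lambda>t. bose (c + d * t))\<bar> \<le> L * D + 1 / w"
    using bd[of 1] by (intro Riemann_sum_error lip m) auto
  also have "\<dots> \<le> \<Delta>" using w unfolding \<Delta>_def L_def by (intro add_left_mono divide_right_mono) auto
  finally show "\<bar>(\<Sum>j<Suc m. bose (c + d * (real j / m))) - m * integral {0..1} (\<lambda>t. bose (c + d * t))\<bar> \<le> \<Delta>" .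
  have "\<bar>(\<Sum>j<Suc m. (real j / m) * bose (c + d * (real j / m))) - m * integral {0..1} (\<lambda>t. t * bose (c + d * t))\<bar>
      \<le> (L * D + 1 / w) + 1 / w"
  proof (rule Riemann_sum_error[where f = "\<lambda>t. t * bose (c + d * t)"])
    fix x y :: real assume xy: "x \<in> {0..1}" "y \<in> {0..1}"
    have "x * bose (c + d * x) - y * bose (c + d * y)
      = x * (bose (c + d * x) - bose (c + d * y)) + bose (c + d * y) * (x - y)"
      by (simp add: algebra_simps)
    also have "\<bar>\<dots>\<bar> \<le> \<bar>x\<bar> * \<bar>bose (c + d * x) - bose (c + d * y)\<bar> + \<bar>bose (c + d * y)\<bar> * \<bar>x - y\<bar>"
      unfolding abs_mult[symmetric] by (rule abs_triangle_ineq)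
    also have "\<dots> \<le> 1 * ((L * D) * \<bar>x - y\<bar>) + 1 / w * \<bar>x - y\<bar>"
      using xy w lip[OF xy] bd[OF xy(2)] by (intro add_mono mult_mono) auto
    finally show "\<bar>x * bose (c + d * x) - y * bose (c + d * y)\<bar> \<le> (L * D + 1 / w) * \<bar>x - y\<bar>"
      by (simp add: distrib_right)
  qed (use bd[of 1] m in auto)
  also have "\<dots> = \<Delta>" by (simp add: \<Delta>_def L_def)
  finally have "m * \<bar>(\<Sum>j<Suc m. (real j / m) * bose (c + d * (real j / m))) - m * integral {0..1} (\<lambda>t. t * bose (c + d * t))\<bar> \<le> m * \<Delta>"
    by (intro mult_left_mono) auto
  also have "m * \<bar>(\<Sum>j<Suc m. (real j / m) * bose (c + d * (real j / m))) - m * integral {0..1} (\<lambda>t. t * bose (c + d * t))\<bar>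
    = \<bar>m * (\<Sum>j<Suc m. (real j / m) * bose (c + d * (real j / m))) - m * (m * integral {0..1} (\<lambda>t. t * bose (c + d * t)))\<bar>"
    by (simp only: abs_mult abs_of_nat right_diff_distrib[symmetric])
  also have "m * (\<Sum>j<Suc m. (real j / m) * bose (c + d * (real j / m))) = (\<Sum>j<Suc m. j * bose (c + d * (real j / m)))"
    unfolding sum_distrib_left using m by (intro sum.cong) auto
  finally show "\<bar>(\<Sum>j<Suc m. j * bose (c + d * (real j / m))) - (real m)\<^sup>2 * integral {0..1} (\<lambda>t. t * bose (c + d * t))\<bar> \<le> \<Delta> * m"
    by (simp only: power2_eq_square of_nat_mult mult.assoc mult.commute[of \<Delta>])
qed

section \<open>Consecutive coefficients\<close>

lemma geom_mean_exp: "0 < y \<Longrightarrow> geom_mean (exp (- y)) = bose y"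
  by (simp add: geom_mean_def bose_def exp_minus field_simps)

lemma exp_remainder_le:
  fixes x :: real
  assumes "0 \<le> x"
  shows "exp x - 1 - x \<le> x * x * exp x"
proof -
  have "x * exp x - x \<le> x * (x * exp x)"
    using mult_left_mono[OF exp_minus_one_le[of x] assms] by (simp add: algebra_simps)
  then show ?thesis using exp_minus_one_le[of x] by linarith
qed

text \<open>With x = d/m, W (N' - N - x N) = exp x (i' - i) + (exp x - 1 - x) i. Relative to i = W N
  the two terms are O(m^(-2)) and O(x/m); dividing by x gives 1/(m d) and 1/m.\<close>

lemma increment_estimate:
  fixes c C D d i i' m N N' W :: real
  assumes c: "0 < c" and C: "0 \<le> C" and d: "0 < d" "d \<le> D" and m: "1 \<le> m" and W: "0 < W"
    and i: "i = W * N" "i' = W * exp (- d / m) * N'"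
    and bounds: "c / m\<^sup>2 \<le> i" "\<bar>i' - i\<bar> \<le> C / m ^ 4"
  shows "0 < N" and "\<bar>N' - N - d / m * N\<bar> \<le> d / m * N * ((exp D * C / c) / (m * d) + D * exp D / m)"
proof -
  have "0 < c / m\<^sup>2" using c m by auto
  then have i0: "0 < i" using bounds(1) by linarith
  then show N: "0 < N" using i W by (simp add: zero_less_mult_iff)
  define x where "x = d / m"
  have D0: "0 \<le> D" using d by linarith
  have "d / m \<le> D / 1" using d m by (intro frac_le) auto
  then have x: "0 < x" "x \<le> D" "x \<le> D / m" using d m by (auto simp: x_def divide_right_mono)
  have ex: "exp x * exp (- x) = 1" by (simp flip: exp_add)
  have "W * N' = exp x * i'" unfolding i(2) using ex by (simp add: x_def)
  then have "W * (N' - N - x * N) = exp x * (i' - i) + (exp x - 1 - x) * i"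
    by (simp add: i(1) algebra_simps)
  also have "\<bar>\<dots>\<bar> \<le> exp x * \<bar>i' - i\<bar> + \<bar>exp x - 1 - x\<bar> * i"
    using abs_triangle_ineq[of "exp x * (i' - i)" "(exp x - 1 - x) * i"] i0 by (simp add: abs_mult)
  also have "\<dots> \<le> exp D * (C / c / m\<^sup>2 * i) + (x * (D / m) * exp D) * i"
  proof (intro add_mono mult_mono)
    have "C / m ^ 4 = C / c / m\<^sup>2 * (c / m\<^sup>2)" using c by (simp add: power4_eq_xxxx power2_eq_square)
    also have "\<dots> \<le> C / c / m\<^sup>2 * i" using bounds(1) C c by (intro mult_left_mono) auto
    finally show "\<bar>i' - i\<bar> \<le> C / c / m\<^sup>2 * i" using bounds(2) by linarith
    have "exp x - 1 - x \<le> x * x * exp x" using x by (intro exp_remainder_le) auto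
    also have "\<dots> \<le> x * (D / m) * exp D" using x D0 m by (intro mult_mono mult_left_mono mult_nonneg_nonneg) auto
    finally show "\<bar>exp x - 1 - x\<bar> \<le> x * (D / m) * exp D"
      using exp_ge_add_one_self[of x] by linarith
  qed (use x i0 D0 m in auto)
  also have "\<dots> = W * (d / m * N * ((exp D * C / c) / (m * d) + D * exp D / m))"
    unfolding i(1) x_def using d m by (simp add: field_simps power2_eq_square)
  finally have "W * \<bar>N' - N - x * N\<bar> \<le> W * (d / m * N * ((exp D * C / c) / (m * d) + D * exp D / m))"
    using W by (simp add: abs_mult)
  from this[unfolded mult_le_cancel_left_pos[OF W]]
  show "\<bar>N' - N - d / m * N\<bar> \<le> d / m * N * ((exp D * C / c) / (m * d) + D * exp D / m)"
    unfolding x_def .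
qed

text \<open>The quantitative form of the theorem, with constants depending only on a0, a1 and b0.
  The bound for A/2 - B is included because it makes 1 / (m d) small.\<close>

lemma num_box_partitions_increment:
  assumes a: "0 < a0" and b: "0 < b0"
  shows "\<exists>C>0. \<exists>M. \<forall>l m n A B. M \<le> m \<longrightarrow> A = real l / m \<longrightarrow> B = real n / (real m)\<^sup>2 \<longrightarrow>
    a0 \<le> A \<longrightarrow> A \<le> a1 \<longrightarrow> b0 \<le> B \<longrightarrow> 2 * B < A \<longrightarrow>
    A / 2 - B \<le> C * parameter_d A B \<and> 0 < parameter_d A B \<and> 0 < num_box_partitions n l m \<and>
    \<bar>real (num_box_partitions (n + 1) l m) - real (num_box_partitions n l m)
        - parameter_d A B / m * real (num_box_partitions n l m)\<bar>
      \<le> parameter_d A B / m * real (num_box_partitions n l m) * (C / (m * parameter_d A B) + C / m)"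
proof (cases "a0 \<le> a1")
  case False
  then have "a0 \<le> A \<Longrightarrow> \<not> A \<le> a1" for A by linarith
  then show ?thesis by (intro exI[of _ "1::real"] conjI exI[of _ "0::nat"]) auto
next
  case True
  with a have a1: "0 < a1" by linarith
  \<comment> \<open>D bounds d by \<open>integral_moment_bose_le\<close>, and w bounds exp c - 1
    from below by \<open>parameter_c_bounds\<close>. Together with exp c - 1 <= 1/a0 they confine
    exp(-(c + d s)), for s in [0, 1], to [q0, q1].\<close>
  define D where "D = 1 / b0"
  define w where "w = exp (- (D * (1 + a1))) / a1"
  define \<Delta> where "\<Delta> = (1 + 1 / w) / w * D + 2 / w"
  define q0 where "q0 = exp (- (ln (1 + 1 / a0) + D))"
  define q1 where "q1 = 1 / (1 + w)"
  have D: "0 < D" using b by (simp add: D_def)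
  have w: "0 < w" using a1 by (simp add: w_def)
  have params: "0 < c \<and> 0 < d \<and> d \<le> D \<and> w \<le> exp c - 1 \<and> exp c - 1 \<le> 1 / a0"
    if p: "is_parameter_pair A B c d" and AB: "a0 \<le> A" "A \<le> a1" "b0 \<le> B" for A B c d
  proof -
    have cd: "0 < c" "0 < d" and A: "A = integral {0..1} (\<lambda>t. bose (c + d * t))"
      and B: "B = integral {0..1} (\<lambda>t. t * bose (c + d * t))"
      using p by (auto simp: is_parameter_pair_iff)
    have "B \<le> 1 / d" unfolding B by (rule integral_moment_bose_le[OF cd])
    then have "b0 \<le> 1 / d" using AB by linarith
    then have dD: "d \<le> D" using cd b by (simp add: D_def field_simps)
    have A0: "0 < A" using a AB by linarith
    note c_bounds = parameter_c_bounds[OF cd(1) cd(2) dD A0 AB(2) integral_bose_identity[OF cd A]]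
    have "1 / A \<le> 1 / a0" using a AB by (intro divide_left_mono) auto
    then show ?thesis using c_bounds cd dD by (auto simp: w_def)
  qed
  have q0: "0 < q0" by (simp add: q0_def)
  have q1: "q1 < 1" using w by (simp add: q1_def)
  have weight: "q0 \<le> exp (- (c + d * s)) \<and> exp (- (c + d * s)) \<le> q1"
    if "0 < c" "0 < d" "d \<le> D" "w \<le> exp c - 1" "exp c - 1 \<le> 1 / a0" "0 \<le> s" "s \<le> 1" for c d s
  proof
    have "c \<le> ln (1 + 1 / a0)"
      using that a by (subst ln_ge_iff) (auto intro: add_pos_pos)
    moreover have "d * s \<le> D * 1" using that by (intro mult_mono) auto
    ultimately show "q0 \<le> exp (- (c + d * s))" by (simp add: q0_def)
    have "exp c \<le> exp (c + d * s)" using that by simp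
    then have "1 + w \<le> exp (c + d * s)" using that by linarith
    then have "1 / exp (c + d * s) \<le> q1"
      unfolding q1_def using w by (intro divide_left_mono) auto
    then show "exp (- (c + d * s)) \<le> q1" by (simp only: exp_minus inverse_eq_divide)
  qed
  show ?thesis
  proof (cases "q0 \<le> q1")
    case False
    \<comment> \<open>If q0 > q1, no weight can lie between them, so there is no parameter pair; by
      existence there are then no admissible A and B, and the claim is vacuous.\<close>
    then have no_pair: "\<not> is_parameter_pair A B c d" if "a0 \<le> A" "A \<le> a1" "b0 \<le> B" for A B c d
      using params[of A B c d] weight[of c d 0] that by (metis order.trans zero_le_one order.refl)
    have "\<not> (a0 \<le> A \<and> A \<le> a1 \<and> b0 \<le> B \<and> 2 * B < A)" for A B
      using no_pair[of A B] parameter_pair_exists[of B A] b by fastforce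
    then show ?thesis by (intro exI[of _ "1::real"] conjI zero_less_one exI[of _ "0::nat"] allI impI) blast+
  next
    case q01: True
    interpret geometric_weights q0 q1 by unfold_locales (fact q0 q01 q1)+
    obtain c0 C0 M where c0: "0 < c0" and C0: "0 < C0" and box: "\<And>q m l n.
        (\<forall>j. q0 \<le> q j \<and> q j \<le> q1) \<Longrightarrow> M \<le> m \<Longrightarrow>
       \<bar>(\<Sum>j<Suc m. geom_mean (q j)) - l\<bar> \<le> \<Delta> \<Longrightarrow>
       \<bar>(\<Sum>j<Suc m. j * geom_mean (q j)) - n\<bar> \<le> \<Delta> * m \<Longrightarrow>
       c0 / (real m)\<^sup>2 \<le> box_integral q m l n \<and>
       \<bar>box_integral q m l (n + 1) - box_integral q m l n\<bar> \<le> C0 / (real m) ^ 4"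
      using box_integral_bounds[of \<Delta>] by blast
    define L where "L = (1 + 1 / w) / w"
    define C where "C = max L (max (exp D * C0 / c0) (D * exp D))"
    have CL: "L \<le> C" "exp D * C0 / c0 \<le> C" "D * exp D \<le> C" by (auto simp: C_def)
    have "0 < C" using D CL(3) by (smt (verit) exp_gt_zero mult_pos_pos)
    moreover have "A / 2 - B \<le> C * parameter_d A B \<and> 0 < parameter_d A B \<and> 0 < num_box_partitions n l m \<and>
      \<bar>real (num_box_partitions (n + 1) l m) - real (num_box_partitions n l m)
          - parameter_d A B / m * real (num_box_partitions n l m)\<bar>
        \<le> parameter_d A B / m * real (num_box_partitions n l m) * (C / (m * parameter_d A B) + C / m)"
      if m: "max 1 M \<le> m" and A: "A = real l / m" and B: "B = real n / (real m)\<^sup>2"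
        and AB: "a0 \<le> A" "A \<le> a1" "b0 \<le> B" "2 * B < A" for l m n A B
    proof -
      define d where "d = parameter_d A B"
      obtain c where p: "is_parameter_pair A B c d"
        unfolding d_def using parameter_d_pair[of B A] AB b by auto
      have cd: "0 < c" "0 < d" "d \<le> D" "w \<le> exp c - 1" "exp c - 1 \<le> 1 / a0"
        using params[OF p AB(1-3)] by auto
      have IA: "A = integral {0..1} (\<lambda>t. bose (c + d * t))"
        and IB: "B = integral {0..1} (\<lambda>t. t * bose (c + d * t))"
        using p by (auto simp: is_parameter_pair_iff)
      have m1: "1 \<le> m" and mM: "M \<le> m" and m0: "0 < m" using m by auto
      define y where "y = exp (- c)"
      define r where "r = exp (- d / m)"
      have yr: "0 < y" "y < 1" "0 < r" "r \<le> 1" using cd by (auto simp: y_def r_def)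
      have yrj: "y * r ^ j = exp (- (c + d * (real j / m)))" for j
        by (simp add: y_def r_def exp_of_nat_mult[symmetric] exp_add[symmetric] mult_ac)
      \<comment> \<open>truncated beyond \<open>m\<close> so that the bounds hold for all indices\<close>
      define q where "q = (\<lambda>j. y * r ^ min j m)"
      have q: "\<forall>j. q0 \<le> q j \<and> q j \<le> q1"
        unfolding q_def yrj using cd m0 by (intro allI weight) (auto simp: divide_le_eq_1)
      have q_eq: "q j = y * r ^ j" if "j < Suc m" for j using that by (simp add: q_def)
      have gm: "geom_mean (q j) = bose (c + d * (real j / m))" if "j < Suc m" for j
        unfolding q_eq[OF that] yrj using cd by (intro geom_mean_exp add_pos_nonneg) auto
      have mA: "real m * A = l" and mB: "(real m)\<^sup>2 * B = n" using m0 by (simp_all add: A B)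
      have "(\<Sum>j<Suc m. geom_mean (q j)) = (\<Sum>j<Suc m. bose (c + d * (real j / m)))"
        "(\<Sum>j<Suc m. j * geom_mean (q j)) = (\<Sum>j<Suc m. j * bose (c + d * (real j / m)))"
        by (intro sum.cong refl; use gm in simp)+
      then have "\<bar>(\<Sum>j<Suc m. geom_mean (q j)) - l\<bar> \<le> \<Delta>"
        "\<bar>(\<Sum>j<Suc m. j * geom_mean (q j)) - n\<bar> \<le> \<Delta> * m"
        using bose_sums_error[OF cd(1) less_imp_le[OF cd(2)] cd(3) w cd(4) m0]
        unfolding IA[symmetric] IB[symmetric] \<Delta>_def of_nat_power mA mB by simp_all
      note bounds = box[OF q mM this]
      \<comment> \<open>\<open>W\<close> carries r^n, so passing to n + 1 multiplies it by r =
        exp(-d/m), the factor expected by \<open>increment_estimate\<close>.\<close>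
      define W where "W = 4 * pi\<^sup>2 * (\<Prod>j<Suc m. 1 - y * r ^ j) * y ^ l * r ^ n"
      have fourier: "box_integral q m l k
        = 4 * pi\<^sup>2 * (\<Prod>j<Suc m. 1 - y * r ^ j) * y ^ l * r ^ k * num_box_partitions k l m" for k :: nat
      proof -
        have eq: "(\<lambda>(t, a). integrand q m l k t a) =
          (\<lambda>(t :: real, a :: real). (\<Prod>j<Suc m. geometric_char (y * r ^ j) (a + j * t)) * cis (- (l * a + k * t)))"
          unfolding integrand_def by (intro ext) (auto simp: q_eq simp del: prod.lessThan_Suc intro!: prod.cong)
        have "continuous_on torus (\<lambda>(t, a). integrand q m l k t a)"
          unfolding case_prod_unfold by (intro continuous_intros) (use q in auto)
        then have "(\<lambda>(t, a). integrand q m l k t a) integrable_on torus"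
          by (rule integrable_continuous)
        from integral_linear[OF this bounded_linear_Re]
        have "box_integral q m l k = Re (integral torus (\<lambda>(t, a). integrand q m l k t a))"
          by (simp add: box_integral_def comp_def case_prod_unfold)
        then show ?thesis unfolding eq integral_geometric_char_prod[OF yr] by (simp only: Re_complex_of_real)
      qed
      have "0 < W"
      proof -
        have "0 < 1 - y * r ^ j" for j
        proof -
          have "0 < c + d * (real j / m)" using cd by (intro add_pos_nonneg) auto
          then show ?thesis unfolding yrj by simp
        qed
        then show ?thesis unfolding W_def using yr
          by (intro mult_pos_pos prod_pos zero_less_power) auto
      qed
      have I1: "box_integral q m l n = W * num_box_partitions n l m"
        unfolding fourier W_def by simp
      have I2: "box_integral q m l (real n + 1) = W * exp (- d / m) * num_box_partitions (n + 1) l m"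
        using fourier[of "n + 1"] by (simp add: W_def r_def mult_ac add.commute)
      note inc = increment_estimate[OF c0 less_imp_le[OF C0] cd(2,3) _ \<open>0 < W\<close> I1 I2
          bounds[THEN conjunct1] bounds[THEN conjunct2]]
      have N: "0 < real (num_box_partitions n l m)" using inc(1) m1 by simp
      have "\<bar>real (num_box_partitions (n + 1) l m) - real (num_box_partitions n l m)
          - d / m * real (num_box_partitions n l m)\<bar>
        \<le> d / m * real (num_box_partitions n l m) * ((exp D * C0 / c0) / (m * d) + D * exp D / m)"
        using inc(2) m1 by simp
      also have "\<dots> \<le> d / m * real (num_box_partitions n l m) * (C / (m * d) + C / m)"
        using CL cd by (intro mult_left_mono add_mono divide_right_mono) auto
      finally have "\<bar>real (num_box_partitions (n + 1) l m) - real (num_box_partitions n l m)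
          - d / m * real (num_box_partitions n l m)\<bar>
        \<le> d / m * real (num_box_partitions n l m) * (C / (m * d) + C / m)" .
      moreover have "A / 2 - B \<le> C * d"
      proof -
        have "A / 2 - B \<le> L * d"
          unfolding IA IB L_def using cd w by (intro integral_bose_defect_le) auto
        also have "\<dots> \<le> C * d" using CL cd by (intro mult_right_mono) auto
        finally show ?thesis .
      qed
      ultimately show ?thesis using cd N unfolding d_def by simp
    qed
    ultimately show ?thesis by blast
  qed
qed

theorem theorem2:
  fixes m l n :: "nat \<Rightarrow> nat"
    and A B :: "nat \<Rightarrow> real"
    and K :: "(real \<times> real) set"
  assumes pos: "\<And>k. m k > 0" "\<And>k. l k > 0" "\<And>k. n k > 0"
    and A_def: "\<And>k. A k = real (l k) / real (m k)"
    and B_def: "\<And>k. B k = real (n k) / real (m k) ^ 2"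
    and K: "compact K" "K \<subseteq> {(x, y). x \<ge> 2 * y \<and> 2 * y > 0}"
    and in_K: "\<And>k. (A k, B k) \<in> K"
    and lim_m: "filterlim m at_top sequentially"
    and lim_l: "filterlim l at_top sequentially"
    and lim_n: "filterlim n at_top sequentially"
    and away: "filterlim
      (\<lambda>k. \<bar>real (n k) - real (l k) * real (m k) / 2\<bar> / real (m k)) at_top sequentially"
  shows "asymp_equiv
      (\<lambda>k. real (num_box_partitions (n k + 1) (l k) (m k))
             - real (num_box_partitions (n k) (l k) (m k)))
      sequentially
      (\<lambda>k. parameter_d (A k) (B k) / real (m k)
             * real (num_box_partitions (n k) (l k) (m k)))"
    (is "asymp_equiv ?f _ ?g")
proof -
  define gap where "gap = (\<lambda>k. \<bar>real (n k) - real (l k) * real (m k) / 2\<bar> / real (m k))"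
  have K_ne: "K \<noteq> {}" using in_K by auto
  obtain p where p: "p \<in> K" "\<And>x. x \<in> K \<Longrightarrow> snd p \<le> snd x"
    using continuous_attains_inf[OF K(1) K_ne continuous_on_snd[OF continuous_on_id]] by blast
  obtain p' where p': "p' \<in> K" "\<And>x. x \<in> K \<Longrightarrow> fst x \<le> fst p'"
    using continuous_attains_sup[OF K(1) K_ne continuous_on_fst[OF continuous_on_id]] by blast
  \<comment> \<open>Compactness enters only here: the second coordinate attains a positive minimum
    on K and the first a maximum.\<close>
  define b0 where "b0 = snd p"
  have b0: "0 < b0" using p(1) K(2) by (auto simp: b0_def)
  have AB: "b0 \<le> B k" "2 * B k \<le> A k" "2 * b0 \<le> A k" "A k \<le> fst p'" for k
    using p(2)[OF in_K[of k]] p'(2)[OF in_K[of k]] in_K[of k] K(2) by (auto simp: b0_def)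
  have gap: "gap k = (A k / 2 - B k) * m k" for k
  proof -
    have "B k * m k = n k / real (m k)" using pos(1)[of k] by (simp add: B_def power2_eq_square)
    then have "(A k / 2 - B k) * m k = (real (l k) * m k / 2 - n k) / m k"
      using pos(1)[of k] by (simp add: A_def field_simps)
    moreover from this have "0 \<le> (real (l k) * m k / 2 - n k) / m k"
      using AB(2)[of k] by (metis diff_ge_0_iff_ge mult_nonneg_nonneg of_nat_0_le_iff pos_le_divide_eq zero_less_numeral mult.commute)
    then have "0 \<le> real (l k) * m k / 2 - n k"
      using pos(1)[of k] by (simp add: zero_le_divide_iff)
    ultimately show ?thesis by (simp add: gap_def abs_if)
  qed
  obtain C M where C: "0 < C" and inc: "\<And>l m n A B. M \<le> m \<Longrightarrow> A = real l / m \<Longrightarrow>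
    B = real n / (real m)\<^sup>2 \<Longrightarrow> 2 * b0 \<le> A \<Longrightarrow> A \<le> fst p' \<Longrightarrow> b0 \<le> B \<Longrightarrow> 2 * B < A \<Longrightarrow>
    A / 2 - B \<le> C * parameter_d A B \<and> 0 < parameter_d A B \<and> 0 < num_box_partitions n l m \<and>
    \<bar>real (num_box_partitions (n + 1) l m) - real (num_box_partitions n l m)
        - parameter_d A B / m * real (num_box_partitions n l m)\<bar>
      \<le> parameter_d A B / m * real (num_box_partitions n l m) * (C / (m * parameter_d A B) + C / m)"
  proof -
    have "0 < 2 * b0" using b0 by simp
    from num_box_partitions_increment[OF this b0, of "fst p'"] that show thesis by blast
  qed
  have lim_gap: "filterlim gap at_top sequentially" using away by (simp add: gap_def)
  have "\<forall>\<^sub>F k in sequentially. norm (?f k / ?g k - 1) \<le> C\<^sup>2 / gap k + C / m k"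
  proof -
    have "\<forall>\<^sub>F k in sequentially. M \<le> m k" using lim_m by (simp add: filterlim_at_top)
    moreover have "\<forall>\<^sub>F k in sequentially. 0 < gap k" using lim_gap by (simp add: filterlim_at_top_dense)
    ultimately show ?thesis
    proof eventually_elim
      case (elim k)
      define d where "d = parameter_d (A k) (B k)"
      define N where "N = real (num_box_partitions (n k) (l k) (m k))"
      have m0: "0 < real (m k)" using pos(1) by simp
      \<comment> \<open>A positive gap excludes A = 2 B, where d is 0 by convention; from here on d
        is the genuine parameter.\<close>
      have "0 < A k / 2 - B k" using elim(2) m0 by (simp add: gap zero_less_mult_iff)
      then have "2 * B k < A k" by linarith
      note estimate = inc[OF elim(1) A_def B_def AB(3,4,1) this, folded d_def N_def]
      have d: "0 < d" and N: "0 < N" using estimate by (auto simp: N_def)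
      have "\<bar>?f k - d / m k * N\<bar> \<le> d / m k * N * (C / (m k * d) + C / m k)"
        using estimate by (simp add: N_def)
      moreover have "0 < d / m k * N" using d N m0 by simp
      ultimately have e1: "\<bar>?f k - d / m k * N\<bar> / (d / m k * N) \<le> C / (m k * d) + C / m k"
        by (subst pos_divide_le_eq) (simp_all only: mult.commute)
      have e2: "?f k / ?g k - 1 = (?f k - d / m k * N) / (d / m k * N)"
      proof -
        have "?g k = d / m k * N" by (simp only: d_def N_def)
        moreover have nz: "d / m k * N \<noteq> 0" using \<open>0 < d / m k * N\<close> by (metis less_irrefl)
        ultimately show ?thesis by (simp only: diff_divide_distrib divide_self[OF nz])
      qed
      \<comment> \<open>The gap is m (A/2 - B) <= C m d, so its divergence controls 1 / (m
        d).\<close>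
      have e3: "C / (m k * d) \<le> C\<^sup>2 / gap k"
      proof -
        have "gap k \<le> (C * d) * m k"
          unfolding gap using estimate m0 by (intro mult_right_mono) auto
        then show ?thesis using elim(2) C d m0 by (simp add: field_simps power2_eq_square)
      qed
      have e4: "norm ((?f k - d / m k * N) / (d / m k * N)) = \<bar>?f k - d / m k * N\<bar> / (d / m k * N)"
        using \<open>0 < d / m k * N\<close> by (simp only: real_norm_def abs_divide abs_of_pos)
      show ?case unfolding e2 e4 by (rule order.trans[OF e1 add_right_mono[OF e3]])
    qed
  qed
  moreover have "(\<lambda>k. C\<^sup>2 / gap k + C / m k) \<longlonglongrightarrow> 0 + 0"
  proof (rule tendsto_add; rule tendsto_divide_0[OF tendsto_const], rule filterlim_at_top_imp_at_infinity)
    show "filterlim gap at_top sequentially" by (rule lim_gap)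
    show "filterlim (\<lambda>k. real (m k)) at_top sequentially"
      by (rule filterlim_compose[OF filterlim_real_sequentially lim_m])
  qed
  then have "(\<lambda>k. C\<^sup>2 / gap k + C / m k) \<longlonglongrightarrow> 0" by (simp only: add_0)
  ultimately have "(\<lambda>k. ?f k / ?g k - 1) \<longlonglongrightarrow> 0"
    by (rule Lim_null_comparison)
  then show ?thesis by (intro asymp_equivI') (rule LIM_zero_cancel)
qed

end
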